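(* Let $\alpha\in(0,1]$, $\lambda>0$, $\mu>0$, $\theta=\lambda+\mu$, and $p=\lambda/\theta$. Suppose $n$ events of the fractional simple birth-death (M/M/1 queue) process are observed, with sojourn times $S_1^\alpha,\dots,S_n^\alpha$ and $n_B$ births among the $n$ events, according to the observation model described in the context. Let $\widehat p=n_B/n$, let $\widehat\theta$ be the method-of-moments estimator of $\theta$ given in the context, and let $\widehat\lambda=\widehat p\,\widehat\theta$. Then, as $n\to\infty$, $$\sqrt n\left(\widehat\lambda-\lambda\right)\stackrel{d}{\longrightarrow}N\left(0,\ \theta^2p(1-p)+p^2\sigma_\theta^2\right),$$ where $$\sigma_\theta^2=\frac{\theta^2\left[20\pi^4(2-\alpha^2)-3\pi^2(\alpha^4+20\alpha^2-32)(\ln\theta)^2-720\,\alpha^3(\ln\theta)\,\zeta(3)\right]}{120\pi^2}$$ and $\zeta(3)$ is the Riemann zeta function evaluated at $3$.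
   Context: Observation model. The sojourn times $S_1^\alpha,\dots,S_n^\alpha$ are independent and identically Mittag--Leffler distributed, with density $$\Pr\{S_k^\alpha\in\mathrm dt\}/\mathrm dt=\theta\,t^{\alpha-1}E_{\alpha,\alpha}\left[-\theta t^\alpha\right],\qquad t>0,\quad \theta=\lambda+\mu,$$ where $E_{\alpha,\beta}(w)=\sum_{r\ge0}w^r/\Gamma(\alpha r+\beta)$ (for $\alpha=1$ this is the exponential distribution with rate $\theta$). Equivalently, $S_k^\alpha\stackrel{d}{=}\mathcal{E}^{1/\alpha}T_\alpha$ with $\mathcal{E}$ exponential of rate $\theta$ and $T_\alpha$ an independent one-sided $\alpha$-stable variable with $\mathbb{E}e^{-\xi T_\alpha}=e^{-\xi^\alpha}$. Each of the $n$ events is a birth with probability $p=\lambda/\theta$ and a death with probability $1-p=\mu/\theta$, independently across events and independently of the sojourn times; $n_B$ and $n_D=n-n_B$ are the numbers of births and deaths. Estimators. Let $S_k^{\alpha'}=\ln S_k^\alpha$, let $\widehat{\mathbb{E}}S_k^{\alpha'}=\frac1n\sum_{k=1}^n S_k^{\alpha'}$ be their sample mean and $\widehat\sigma^2_{S_k^{\alpha'}}=\frac{1}{n-1}\sum_{k=1}^n\left(S_k^{\alpha'}-\widehat{\mathbb{E}}S_k^{\alpha'}\right)^2$ their sample variance. Then $$\widehat\alpha=\frac{\pi}{\sqrt{3\left(\widehat\sigma^2_{S_k^{\alpha'}}+\pi^2/6\right)}},\qquad \widehat\theta=\exp\left(-\widehat\alpha\left(\widehat{\mathbb{E}}S_k^{\alpha'}+\gamma\right)\right),$$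 where $\gamma\approx0.5772$ is the Euler--Mascheroni constant. *)

theory Defs
  imports "HOL-Probability.Probability"
begin

definition mittag_leffler :: "real \<Rightarrow> real \<Rightarrow> real \<Rightarrow> real" where
  "mittag_leffler a b w = (\<Sum>r. w ^ r / Gamma (a * real r + b))"

text \<open>
  Lebesgue density of the Mittag-Leffler waiting time; the law is concentrated on the positive
  half-line.
\<close>

definition ml_density :: "real \<Rightarrow> real \<Rightarrow> real \<Rightarrow> real" where
  "ml_density \<alpha> \<theta> t =
     (if t > 0 then \<theta> * t powr (\<alpha> - 1) * mittag_leffler \<alpha> \<alpha> (- \<theta> * t powr \<alpha>) else 0)"

text \<open>Only meaningful for \<open>s > 1\<close>, where the Dirichlet series converges.\<close>

definition riemann_zeta :: "real \<Rightarrow> real" where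
  "riemann_zeta s = (\<Sum>n. 1 / real (Suc n) powr s)"

text \<open>
  In the following, the data are the first \<open>n\<close> terms of a sequence: the indices \<open>k = 1, \<dots>, n\<close>
  are shifted to \<open>k < n\<close>.
\<close>

definition sample_mean :: "nat \<Rightarrow> (nat \<Rightarrow> real) \<Rightarrow> real" where
  "sample_mean n x = (\<Sum>k<n. x k) / real n"

definition sample_variance :: "nat \<Rightarrow> (nat \<Rightarrow> real) \<Rightarrow> real" where
  "sample_variance n x = (\<Sum>k<n. (x k - sample_mean n x)\<^sup>2) / (real n - 1)"

definition alpha_hat :: "nat \<Rightarrow> (nat \<Rightarrow> real) \<Rightarrow> real" where
  "alpha_hat n s = pi / sqrt (3 * (sample_variance n (\<lambda>k. ln (s k)) + pi\<^sup>2 / 6))"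

definition theta_hat :: "nat \<Rightarrow> (nat \<Rightarrow> real) \<Rightarrow> real" where
  "theta_hat n s = exp (- alpha_hat n s * (sample_mean n (\<lambda>k. ln (s k)) + euler_mascheroni))"

text \<open>\<open>b k\<close> means that the \<open>k\<close>-th event is a birth; otherwise it is a death.\<close>

definition p_hat :: "nat \<Rightarrow> (nat \<Rightarrow> bool) \<Rightarrow> real" where
  "p_hat n b = real (card {k. k < n \<and> b k}) / real n"

definition lambda_hat :: "nat \<Rightarrow> (nat \<Rightarrow> real) \<Rightarrow> (nat \<Rightarrow> bool) \<Rightarrow> real" where
  "lambda_hat n s b = p_hat n b * theta_hat n s"

definition sigma_theta_sq :: "real \<Rightarrow> real \<Rightarrow> real" where
  "sigma_theta_sq \<alpha> \<theta> =
     \<theta>\<^sup>2 * (20 * pi ^ 4 * (2 - \<alpha>\<^sup>2)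
          - 3 * pi\<^sup>2 * (\<alpha> ^ 4 + 20 * \<alpha>\<^sup>2 - 32) * (ln \<theta>)\<^sup>2
          - 720 * \<alpha> ^ 3 * ln \<theta> * riemann_zeta 3) / (120 * pi\<^sup>2)"

end

(*
  With f the Mittag-Leffler density, f and its convolution with the kernel
  theta t^(alpha-1) / Gamma(alpha) satisfy a Volterra equation, which gives the Laplace transform
  E exp(-xi S) = theta / (theta + xi^alpha). If E, E' are independent standard exponential
  variables, independent of S, then P(E > xi S) is this Laplace transform, so
  alpha (ln E - ln S) - ln theta and ln E - ln E' have the same (logistic) law. Hence the first four
  moments of ln S follow from those of ln E, which are read off the derivatives at s = 0 of
  E exp(s ln E) = Gamma(1 + s), i.e. from polygamma values at 1. The estimator is a differentiable
  function of the sample means of 1_birth, ln S and (ln S)^2 and of 1 / (n - 1); the delta method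
  linearises it, the linear part splits into independent sums over S and over B, and the central
  limit theorem applies to each.
*)

theory Submission
  imports Defs "HOL-Real_Asymp.Real_Asymp"
begin

section \<open>Values of the polygamma functions at 1\<close>

text \<open>The law of S enters only through its Laplace transform, and only moments of ln S are
  wanted; the independent E turns the transform into a tail probability, so that the infinite mean
  of S for \<alpha> < 1 does no harm. The odd moments of the logistic law vanish, which forces the
  centred third moments of ln S and ln E to agree: this is where -2 \<zeta>(3) comes from.
  Integrating the Mittag-Leffler series term by term would give the transform only where \<xi> powr
  \<alpha> > \<theta>, the region of convergence of a geometric series; the tail calls for every
  \<xi> > 0, and the Volterra equation supplies this. In the limit the birth indicators contribute
  \<theta>^2 p (1 - p). A sojourn time with centred logarithm T contributes - p \<theta> (\<alpha> T
  + c (T^2 - t2)), where t2 is the variance of T and c = 3 \<alpha>^2 ln \<theta> / (2 pi^2) comes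
  from differentiating the estimator of \<alpha> in the sample variance.\<close>

lemma digamma_reflection:
  fixes s :: real
  assumes "0 < s" "s < 1"
  shows "Digamma (1 + s) - Digamma (1 - s) = 1 / s - pi * cos (pi * s) / sin (pi * s)"
proof -
  \<comment> \<open>The reflection formula makes F linear on (0, 1), with derivative pi; the product
    rule gives a second expression for this derivative, in which the digamma difference occurs. The
    arguments 1 + s and 1 - s stay away from the poles of Gamma.\<close>
  define F where "F = (\<lambda>s::real. Gamma (1 + s) * Gamma (1 - s) * sin (pi * s))"
  have F: "F t = pi * t" if "0 < t" "t < 1" for t
  proof -
    have "t \<notin> \<int>"
      using that by (auto elim!: Ints_cases)
    then have "sin (pi * t) \<noteq> 0"
      by (subst sin_times_pi_eq_0[of t, simplified mult.commute]) auto
    moreover have "Gamma (1 + t) = t * Gamma t"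
      using that nonpos_Ints_nonpos[of t] Gamma_plus1[of t] by (auto simp: add.commute)
    moreover have "Gamma t * Gamma (1 - t) = pi / sin (pi * t)"
    proof -
      have "complex_of_real (Gamma t * Gamma (1 - t)) = of_real (pi / sin (pi * t))"
        using Gamma_reflection_complex[of "of_real t"]
        by (simp flip: Gamma_complex_of_real sin_of_real)
      then show ?thesis
        by (simp only: of_real_eq_iff)
    qed
    ultimately show ?thesis
      unfolding F_def by (simp add: mult.assoc)
  qed
  have npos: "1 + s \<notin> \<int>\<^sub>\<le>\<^sub>0" "1 - s \<notin> \<int>\<^sub>\<le>\<^sub>0"
    using assms by (auto elim!: nonpos_Ints_cases)
  have "(F has_real_derivative Gamma (1 + s) * Gamma (1 - s)
      * ((Digamma (1 + s) - Digamma (1 - s)) * sin (pi * s) + pi * cos (pi * s))) (at s)"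
    unfolding F_def using npos by (auto intro!: derivative_eq_intros simp: algebra_simps)
  moreover have "(F has_real_derivative pi) (at s)"
  proof (rule has_field_derivative_transform_within_open)
    show "((\<lambda>t. pi * t) has_real_derivative pi) (at s)"
      by (auto intro!: derivative_eq_intros)
    show "open {0<..<1::real}" "s \<in> {0<..<1}" "\<And>t. t \<in> {0<..<1} \<Longrightarrow> pi * t = F t"
      using assms F by auto
  qed
  ultimately have "Gamma (1 + s) * Gamma (1 - s)
      * ((Digamma (1 + s) - Digamma (1 - s)) * sin (pi * s) + pi * cos (pi * s)) = pi"
    by (rule DERIV_unique)
  \<comment> \<open>The extra factor sin (pi * s) completes the Gamma product to F s = pi * s, which
    eliminates Gamma.\<close>
  then have "(Gamma (1 + s) * Gamma (1 - s) * sin (pi * s))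
      * ((Digamma (1 + s) - Digamma (1 - s)) * sin (pi * s) + pi * cos (pi * s)) = pi * sin (pi * s)"
    by (metis mult.assoc mult.commute)
  then have "s * ((Digamma (1 + s) - Digamma (1 - s)) * sin (pi * s) + pi * cos (pi * s)) = sin (pi * s)"
    using F[of s] assms unfolding F_def by simp
  moreover have "sin (pi * s) > 0"
    using assms by (intro sin_gt_zero) auto
  ultimately show ?thesis
    using assms by (simp add: field_simps)
qed

text \<open>Removing the \<zeta>(2) term from the partial fractions of the cotangent leaves 2 s^3
  R(s), where R(s) is the sum of 1 / (m^2 (m^2 - s^2)) over m >= 1. As s -> 0 the series tends to
  \<zeta>(4), and the closed form tends to a Taylor coefficient of the cotangent.\<close>

lemma inverse_fourth_powers_sums: "(\<lambda>n. 1 / real (Suc n) ^ 4) sums (pi ^ 4 / 90)"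
proof -
  have sm4: "summable (\<lambda>n. 1 / real (Suc n) ^ 4)"
    using inverse_power_summable[of 4, where 'a=real]
    by (subst summable_Suc_iff) (simp add: field_simps)
  define K where "K = (\<Sum>n. 1 / real (Suc n) ^ 4)"
  define R where "R = (\<lambda>s::real. ((1 / s - pi * cos (pi * s) / sin (pi * s)) - pi\<^sup>2 / 3 * s) / (2 * s ^ 3))"
  have bounds: "K \<le> R s \<and> R s \<le> K / (1 - s\<^sup>2)" if s: "0 < s" "s < 1" for s
  proof -
    have dg: "(\<lambda>k. inverse (real (Suc k)) - inverse (z + real k)) sums (Digamma z + euler_mascheroni)"
      if "z > 0" for z :: real
    proof -
      have "z \<noteq> 0" using that by simp
      from summable_Digamma[OF this]
      show ?thesis unfolding Digamma_def by (simp add: summable_sums)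
    qed
    have "(\<lambda>k. (inverse (real (Suc k)) - inverse (1 + s + real k)) - (inverse (real (Suc k)) - inverse (1 - s + real k)))
        sums ((Digamma (1 + s) + euler_mascheroni) - (Digamma (1 - s) + euler_mascheroni))"
      using s by (intro sums_diff dg) auto
    then have 1: "(\<lambda>k. inverse (1 - s + real k) - inverse (1 + s + real k)) sums (1 / s - pi * cos (pi * s) / sin (pi * s))"
      using digamma_reflection[OF s] by simp
    have 2: "(\<lambda>k. 2 * s * (1 / (real k + 1)\<^sup>2)) sums (2 * s * (pi\<^sup>2 / 6))"
      using inverse_squares_sums by (intro sums_mult) (simp add: add.commute)
    have 3: "((inverse (1 - s + real k) - inverse (1 + s + real k)) - 2 * s * (1 / (real k + 1)\<^sup>2)) / (2 * s ^ 3)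
       = 1 / ((real k + 1)\<^sup>2 * ((real k + 1)\<^sup>2 - s\<^sup>2))" for k
    proof -
      define m where "m = real k + 1"
      have m: "m \<ge> 1" unfolding m_def by simp
      have e: "1 - s + real k = m - s" "1 + s + real k = m + s" by (simp_all add: m_def)
      have nz: "m - s \<noteq> 0" "m + s \<noteq> 0" "m \<noteq> 0" using s m by auto
      define q where "q = m\<^sup>2"
      have q: "q - s\<^sup>2 = (m - s) * (m + s)"
        by (simp add: q_def power2_eq_square algebra_simps)
      then have d: "inverse (m - s) - inverse (m + s) = 2 * s / (q - s\<^sup>2)"
        using nz by (simp add: field_simps)
      moreover have "q - s\<^sup>2 \<noteq> 0" "q \<noteq> 0"
        using nz q by (auto simp: q_def)
      ultimately show ?thesis
        unfolding e m_def[symmetric] d q_def[symmetric] using s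
        by (simp add: divide_simps) (simp add: algebra_simps power2_eq_square power3_eq_cube)
    qed
    have 4: "(\<lambda>k. 1 / ((real k + 1)\<^sup>2 * ((real k + 1)\<^sup>2 - s\<^sup>2))) sums R s"
      using sums_divide[OF sums_diff[OF 1 2], of "2 * s ^ 3"] unfolding 3 R_def by (simp add: field_simps)
    \<comment> \<open>With q = m^2 >= 1 one has q (1 - s^2) <= q - s^2 <= q. The factor 1 - s^2 is
      uniform in the index, so the whole series is squeezed at once.\<close>
    have cmp: "1 / real (Suc k) ^ 4 \<le> 1 / ((real k + 1)\<^sup>2 * ((real k + 1)\<^sup>2 - s\<^sup>2)) \<and>
        1 / ((real k + 1)\<^sup>2 * ((real k + 1)\<^sup>2 - s\<^sup>2)) \<le> 1 / real (Suc k) ^ 4 / (1 - s\<^sup>2)" for k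
    proof -
      define q where "q = (real k + 1)\<^sup>2"
      have q: "q \<ge> 1" unfolding q_def by simp
      have s2: "0 < s\<^sup>2" "s\<^sup>2 < 1" using s by (auto simp: power_less_one_iff)
      have "real (Suc k) ^ 4 = q * q" unfolding q_def by (simp add: power2_eq_square power4_eq_xxxx algebra_simps)
      moreover have "q * (1 - s\<^sup>2) \<le> q - s\<^sup>2" using q s2 by (simp add: algebra_simps)
      moreover have "q - s\<^sup>2 > 0" using q s2 by linarith
      ultimately show ?thesis
        unfolding q_def[symmetric] using q s2 by (auto simp: field_simps)
    qed
    have "K \<le> R s"
      unfolding K_def by (rule sums_le[OF _ summable_sums[OF sm4] 4]) (use cmp in auto)
    moreover have "R s \<le> K / (1 - s\<^sup>2)"
      unfolding K_def by (rule sums_le[OF _ 4 sums_divide[OF summable_sums[OF sm4]]]) (use cmp in auto)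
    ultimately show ?thesis by simp
  qed
  have ev: "\<forall>\<^sub>F s in at_right 0. 0 < s \<and> s < (1::real)"
    by (auto simp: eventually_at_right_field intro!: exI[of _ 1])
  have "(R \<longlongrightarrow> K) (at_right 0)"
  proof (rule tendsto_sandwich)
    show "\<forall>\<^sub>F s in at_right 0. K \<le> R s" "\<forall>\<^sub>F s in at_right 0. R s \<le> K / (1 - s\<^sup>2)"
      using ev by (eventually_elim, use bounds in auto)+
    show "((\<lambda>s. K / (1 - s\<^sup>2)) \<longlongrightarrow> K) (at_right 0)"
      by (auto intro!: tendsto_eq_intros)
  qed auto
  moreover have "(R \<longlongrightarrow> pi ^ 4 / 90) (at_right 0)"
  proof -
    \<comment> \<open>The rescaling u = pi * s leaves a limit without parameters; 1 / 90 is half the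
      coefficient 1 / 45 of u^3 in 1 / u - u / 3 - cot u.\<close>
    have "((\<lambda>u::real. (1 / u - cos u / sin u - u / 3) / (2 * u ^ 3)) \<longlongrightarrow> 1 / 90) (at_right 0)"
      by real_asymp
    moreover have "filterlim (\<lambda>s. pi * s) (at_right 0) (at_right 0)"
      by real_asymp
    ultimately have "((\<lambda>s. pi ^ 4 * ((1 / (pi * s) - cos (pi * s) / sin (pi * s) - pi * s / 3)
        / (2 * (pi * s) ^ 3))) \<longlongrightarrow> pi ^ 4 * (1 / 90)) (at_right 0)"
      by (intro tendsto_mult tendsto_const) (rule filterlim_compose)
    moreover have "pi ^ 4 * ((1 / (pi * s) - cos (pi * s) / sin (pi * s) - pi * s / 3) / (2 * (pi * s) ^ 3)) = R s" for s
    proof -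
      have "pi * (1 / (pi * s) - cos (pi * s) / sin (pi * s) - pi * s / 3)
          = 1 / s - pi * cos (pi * s) / sin (pi * s) - pi\<^sup>2 / 3 * s"
        by (simp add: algebra_simps power2_eq_square)
      moreover have "pi ^ 4 * (x / (2 * (pi * s) ^ 3)) = pi * x / (2 * s ^ 3)" for x
        by (simp add: power_mult_distrib field_simps power4_eq_xxxx power3_eq_cube)
      ultimately show ?thesis
        unfolding R_def by (simp only:)
    qed
    ultimately show ?thesis by simp
  qed
  ultimately have "K = pi ^ 4 / 90"
    by (intro tendsto_unique[of "at_right 0"]) auto
  then show ?thesis
    using summable_sums[OF sm4] unfolding K_def by (simp only:)
qed

text \<open>Up to sign the polygamma series of order n at 1 is n! \<zeta>(n + 1). These three values
  are the second, third and fourth cumulants of ln E.\<close>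

lemma Polygamma_at_1:
  "Polygamma 1 (1::real) = pi\<^sup>2 / 6"
  "Polygamma 2 (1::real) = - 2 * riemann_zeta 3"
  "Polygamma 3 (1::real) = pi ^ 4 / 15"
proof -
  show "Polygamma 1 (1::real) = pi\<^sup>2 / 6"
    using sums_unique[OF inverse_squares_sums]
    by (simp add: Polygamma_def field_simps power2_eq_square)
  have "inverse ((1 + real k) ^ Suc 2) = 1 / real (Suc k) powr 3" for k
    by (subst powr_realpow[symmetric]) (auto simp: field_simps)
  then show "Polygamma 2 (1::real) = - 2 * riemann_zeta 3"
    by (simp add: Polygamma_def riemann_zeta_def fact_numeral)
  have "inverse ((1 + real k) ^ Suc 3) = 1 / real (Suc k) ^ 4" for k
    by (simp add: field_simps)
  then show "Polygamma 3 (1::real) = pi ^ 4 / 15"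
    using sums_unique[OF inverse_fourth_powers_sums]
    by (simp add: Polygamma_def fact_numeral)
qed

text \<open>Termwise differentiation replaces the coefficients by \<open>diffs c\<close> and shifts
  the family \<open>F\<close>, so induction on m peels off one derivative at a time. Supplying the
  derivatives as a family allows closed formulas to be verified one step at a time.\<close>

lemma power_series_eq_deriv:
  fixes c :: "nat \<Rightarrow> real" and F :: "nat \<Rightarrow> real \<Rightarrow> real"
  assumes "r > 0"
    and "\<And>s. \<bar>s\<bar> < r \<Longrightarrow> (\<lambda>j. c j * s ^ j) sums F 0 s"
    and "\<And>j s. j < m \<Longrightarrow> \<bar>s\<bar> < r \<Longrightarrow> (F j has_real_derivative F (Suc j) s) (at s)"
  shows "F m 0 = fact m * c m"
  using assms(2,3)
proof (induction m arbitrary: c F)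
  case 0
  have "(\<lambda>j. c j * 0 ^ j) sums F 0 0"
    using 0(1)[of 0] assms(1) by simp
  moreover have "(\<lambda>j. c j * 0 ^ j) sums c 0"
    by (rule powser_sums_zero)
  ultimately show ?case
    by (auto dest: sums_unique2)
next
  case (Suc m)
  have "(\<lambda>j. diffs c j * s ^ j) sums F 1 s" if s: "\<bar>s\<bar> < r" for s
  proof -
    define K where "K = (\<bar>s\<bar> + r) / 2"
    have K: "\<bar>s\<bar> < K" "K < r" "K > 0" using s unfolding K_def by auto
    have smK: "summable (\<lambda>j. c j * K ^ j)"
      using Suc.prems(1)[of K] K by (auto simp: sums_iff)
    have d: "((\<lambda>x. \<Sum>n. c n * x ^ n) has_real_derivative (\<Sum>n. diffs c n * s ^ n)) (at s)"
      by (rule termdiffs_strong[OF smK]) (use K in auto)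
    have "(F 0 has_real_derivative (\<Sum>n. diffs c n * s ^ n)) (at s)"
    proof (rule has_field_derivative_transform_within_open[OF d])
      show "open {-r<..<r}" "s \<in> {-r<..<r}" using s by auto
      show "\<And>x. x \<in> {-r<..<r} \<Longrightarrow> (\<Sum>n. c n * x ^ n) = F 0 x"
        using Suc.prems(1) by (auto simp: sums_iff abs_less_iff)
    qed
    moreover have "(F 0 has_real_derivative F 1 s) (at s)"
      using Suc.prems(2)[of 0 s] s by simp
    ultimately have "F 1 s = (\<Sum>n. diffs c n * s ^ n)"
      by (metis DERIV_unique)
    moreover have "summable (\<lambda>n. diffs c n * s ^ n)"
    proof (rule termdiff_converges[of s r c])
      show "norm s < r" using s by simp
      show "\<And>x. norm x < r \<Longrightarrow> summable (\<lambda>n. c n * x ^ n)"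
        using Suc.prems(1) by (auto simp: sums_iff)
    qed
    ultimately show ?thesis by (simp add: sums_iff)
  qed
  then have "F (Suc m) 0 = fact m * diffs c m"
    using Suc.IH[of "diffs c" "\<lambda>j. F (Suc j)"] Suc.prems(2) by auto
  then show ?case
    by (simp add: diffs_def algebra_simps)
qed

section \<open>Moments of the logarithm of an exponential variable\<close>

text \<open>A single term of the exponential series gives (K |x|)^j / j! <= exp (K |x|), which is at
  most exp (K x) + exp (- K x); K = r / 2 keeps both exponents in the admissible range.\<close>

lemma exp_moment_imp_integrable_power:
  fixes X :: "'a \<Rightarrow> real"
  assumes "r > 0" and [measurable]: "X \<in> borel_measurable M"
    and "\<And>s. \<bar>s\<bar> < r \<Longrightarrow> integrable M (\<lambda>x. exp (s * X x))"
  shows "integrable M (\<lambda>x. X x ^ j)"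
proof (rule Bochner_Integration.integrable_bound)
  define K where "K = r / 2"
  have K: "K > 0" "K < r" using assms(1) by (auto simp: K_def)
  show "integrable M (\<lambda>x. fact j / K ^ j * (exp (K * X x) + exp (- K * X x)))"
    using K by (intro integrable_mult_right Bochner_Integration.integrable_add assms(3)) auto
  show "AE x in M. norm (X x ^ j) \<le> norm (fact j / K ^ j * (exp (K * X x) + exp (- K * X x)))"
  proof (rule AE_I2)
    fix x
    have "(K * \<bar>X x\<bar>) ^ j / fact j \<le> exp (K * \<bar>X x\<bar>)"
      using sum_le_suminf[OF sums_summable[OF exp_converges[of "K * \<bar>X x\<bar>"]], of "{j}"] K
        sums_unique[OF exp_converges[of "K * \<bar>X x\<bar>"]]
      by (simp add: scaleR_conv_of_real field_simps)
    also have "\<dots> \<le> exp (K * X x) + exp (- K * X x)"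
      by (cases "X x \<ge> 0") auto
    finally have "\<bar>X x\<bar> ^ j \<le> fact j / K ^ j * (exp (K * X x) + exp (- K * X x))"
      using K by (simp add: field_simps power_mult_distrib)
    then show "norm (X x ^ j) \<le> norm (fact j / K ^ j * (exp (K * X x) + exp (- K * X x)))"
      using K by (simp add: power_abs)
  qed
qed auto

text \<open>The exponential series is integrated term by term. Partial sums of absolute values stay
  below exp (s X) + exp (- s X), which is integrable because the range of s is symmetric about
  0.\<close>

lemma exp_moment_power_series:
  fixes X :: "'a \<Rightarrow> real"
  assumes r: "r > 0" and [measurable]: "X \<in> borel_measurable M"
    and ei: "\<And>s. \<bar>s\<bar> < r \<Longrightarrow> integrable M (\<lambda>x. exp (s * X x))"
    and s: "\<bar>s\<bar> < r"
  shows "(\<lambda>j. (\<integral>x. X x ^ j \<partial>M) / fact j * s ^ j) sums (\<integral>x. exp (s * X x) \<partial>M)"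
proof -
  define f where "f = (\<lambda>j x. (s * X x) ^ j / fact j)"
  have pow: "integrable M (\<lambda>x. X x ^ j)" for j
    by (rule exp_moment_imp_integrable_power[OF r]) (auto intro: ei)
  have f_int: "integrable M (f j)" for j
    unfolding f_def power_mult_distrib
    by (intro integrable_divide integrable_mult_right pow)
  have f_sums: "(\<lambda>j. f j x) sums exp (s * X x)" for x
    using exp_converges[of "s * X x"] by (simp add: f_def scaleR_conv_of_real field_simps)
  have nf: "norm (f j x) = \<bar>s * X x\<bar> ^ j / fact j" for j x
    by (simp add: f_def power_abs)
  have n_sums: "(\<lambda>j. norm (f j x)) sums exp \<bar>s * X x\<bar>" for x
    using exp_converges[of "\<bar>s * X x\<bar>"] unfolding nf by (simp add: scaleR_conv_of_real field_simps)
  have dom: "integrable M (\<lambda>x. exp (s * X x) + exp (- s * X x))"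
    using s by (intro Bochner_Integration.integrable_add ei) auto
  have "(\<lambda>j. integral\<^sup>L M (f j)) sums (\<integral>x. (\<Sum>j. f j x) \<partial>M)"
  proof (rule sums_integral)
    show "AE x in M. summable (\<lambda>j. norm (f j x))"
      using n_sums by (auto simp: sums_iff)
    show "summable (\<lambda>j. \<integral>x. norm (f j x) \<partial>M)"
    proof (rule summableI_nonneg_bounded)
      fix n
      have "(\<Sum>j<n. \<integral>x. norm (f j x) \<partial>M) = (\<integral>x. (\<Sum>j<n. norm (f j x)) \<partial>M)"
        by (rule Bochner_Integration.integral_sum[symmetric]) (intro integrable_norm f_int)
      also have "\<dots> \<le> (\<integral>x. exp (s * X x) + exp (- s * X x) \<partial>M)"
      proof (rule integral_mono[OF _ dom])
        show "integrable M (\<lambda>x. \<Sum>j<n. norm (f j x))"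
          by (intro Bochner_Integration.integrable_sum integrable_norm f_int)
        fix x
        have "(\<Sum>j<n. norm (f j x)) \<le> exp \<bar>s * X x\<bar>"
          using n_sums[of x] by (metis norm_ge_zero sums_iff sum_le_suminf finite_lessThan)
        also have "\<dots> \<le> exp (s * X x) + exp (- s * X x)"
          by (cases "s * X x \<ge> 0") auto
        finally show "(\<Sum>j<n. norm (f j x)) \<le> exp (s * X x) + exp (- s * X x)" .
      qed
      finally show "(\<Sum>j<n. \<integral>x. norm (f j x) \<partial>M) \<le> (\<integral>x. exp (s * X x) + exp (- s * X x) \<partial>M)" .
    qed auto
  qed (rule f_int)
  moreover have "(\<Sum>j. f j x) = exp (s * X x)" for x
    using f_sums by (simp add: sums_iff)
  moreover have "integral\<^sup>L M (f j) = (\<integral>x. X x ^ j \<partial>M) / fact j * s ^ j" for j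
    unfolding f_def by (simp add: power_mult_distrib)
  ultimately show ?thesis by simp
qed

text \<open>A bare measure, so that E and E' can be realised as coordinates of a product
  space.\<close>

definition std_exponential :: "real measure" where
  "std_exponential = density lborel (\<lambda>x. ennreal (exponential_density 1 x))"

lemma prob_space_std_exponential: "prob_space std_exponential"
  unfolding std_exponential_def by (rule prob_space_exponential_density) simp

lemma sets_std_exponential [simp, measurable_cong]: "sets std_exponential = sets borel"
  and space_std_exponential [simp]: "space std_exponential = UNIV"
  by (simp_all add: std_exponential_def)

lemma AE_std_exponential_pos: "AE x in std_exponential. x > 0"
proof -
  have "AE x in lborel. x \<noteq> (0::real)" by (rule AE_lborel_singleton)
  then show ?thesis
    unfolding std_exponential_def
    by (subst AE_density) (auto simp: exponential_density_def elim!: eventually_mono)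
qed

text \<open>Euler's integral for Gamma at 1 + s. Adding \<open>euler_mascheroni\<close> centres ln
  E, whose mean is \<open>Digamma 1\<close>.\<close>

lemma log_exponential_mgf:
  assumes "\<bar>s\<bar> < 1"
  shows "integrable std_exponential (\<lambda>x. exp (s * (ln x + euler_mascheroni)))"
    and "(\<integral>x. exp (s * (ln x + euler_mascheroni)) \<partial>std_exponential)
      = exp (euler_mascheroni * s) * Gamma (1 + s)"
proof -
  have "(\<integral>\<^sup>+x. ennreal (exp (s * (ln x + euler_mascheroni))) \<partial>std_exponential)
      = (\<integral>\<^sup>+x. ennreal (exponential_density 1 x) * ennreal (exp (s * (ln x + euler_mascheroni))) \<partial>lborel)"
    unfolding std_exponential_def by (subst nn_integral_density) auto
  also have "\<dots> = (\<integral>\<^sup>+x. ennreal (exp (euler_mascheroni * s))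
      * ennreal (indicator {0..} x * x powr (1 + s - 1) / exp x) \<partial>lborel)"
  proof (rule nn_integral_cong_AE)
    have "AE x in lborel. x \<noteq> (0::real)" by (rule AE_lborel_singleton)
    then show "AE x in lborel. ennreal (exponential_density 1 x) * ennreal (exp (s * (ln x + euler_mascheroni)))
        = ennreal (exp (euler_mascheroni * s)) * ennreal (indicator {0..} x * x powr (1 + s - 1) / exp x)"
    proof eventually_elim
      case (elim x)
      then show ?case
        by (cases "x > 0")
           (auto simp: exponential_density_def powr_def algebra_simps exp_add exp_minus field_simps
              simp flip: ennreal_mult')
    qed
  qed
  also have "\<dots> = ennreal (exp (euler_mascheroni * s)) * Gamma (1 + s)"
    using assms by (subst nn_integral_cmult) (auto simp: Gamma_conv_nn_integral_real)
  also have "\<dots> = ennreal (exp (euler_mascheroni * s) * Gamma (1 + s))"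
    by (simp add: ennreal_mult')
  finally have "(\<integral>\<^sup>+x. ennreal (exp (s * (ln x + euler_mascheroni))) \<partial>std_exponential)
      = ennreal (exp (euler_mascheroni * s) * Gamma (1 + s))" .
  moreover have "Gamma (1 + s) \<ge> 0"
    using assms by (intro less_imp_le[OF Gamma_real_pos]) auto
  ultimately show "integrable std_exponential (\<lambda>x. exp (s * (ln x + euler_mascheroni)))"
    "(\<integral>x. exp (s * (ln x + euler_mascheroni)) \<partial>std_exponential)
      = exp (euler_mascheroni * s) * Gamma (1 + s)"
    by (subst (asm) nn_integral_eq_integrable; auto)+
qed

lemma log_exponential_moments:
  defines "m j \<equiv> (\<integral>x. (ln x + euler_mascheroni) ^ j \<partial>std_exponential)"
  shows "integrable std_exponential (\<lambda>x. (ln x + euler_mascheroni) ^ j)"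
    and "m 1 = 0" "m 2 = pi\<^sup>2 / 6" "m 3 = - 2 * riemann_zeta 3" "m 4 = 3 * pi ^ 4 / 20"
proof -
  show "integrable std_exponential (\<lambda>x. (ln x + euler_mascheroni) ^ j)"
    by (rule exp_moment_imp_integrable_power[of 1]) (auto intro!: log_exponential_mgf)
  define F0 where "F0 = (\<lambda>s::real. exp (euler_mascheroni * s) * Gamma (1 + s))"
  define d where "d = (\<lambda>s::real. Digamma (1 + s) + euler_mascheroni)"
  define P where "P = (\<lambda>k s::real. Polygamma k (1 + s))"
  \<comment> \<open>The entries are the complete Bell polynomials in \<open>d\<close>,
    \<open>P 1\<close>, \<open>P 2\<close>, \<open>P 3\<close>: as \<open>F0\<close> has logarithmic
    derivative \<open>d\<close>, they are its successive derivatives divided by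
    \<open>F0\<close>.\<close>
  define F where "F = (\<lambda>j s. F0 s * [1, d s, d s ^ 2 + P 1 s, d s ^ 3 + 3 * d s * P 1 s + P 2 s,
      d s ^ 4 + 6 * d s ^ 2 * P 1 s + 3 * P 1 s ^ 2 + 4 * d s * P 2 s + P 3 s] ! j)"
  have sums: "(\<lambda>j. m j / fact j * s ^ j) sums F 0 s" if "\<bar>s\<bar> < 1" for s
    using exp_moment_power_series[OF _ _ log_exponential_mgf(1), of 1 s] log_exponential_mgf(2)[of s] that
    by (simp add: m_def F_def F0_def)
  have deriv: "(F j has_real_derivative F (Suc j) s) (at s)" if j: "j < 4" and s: "\<bar>s\<bar> < 1" for j s
  proof -
    have np: "1 + s \<notin> \<int>\<^sub>\<le>\<^sub>0" using s nonpos_Ints_nonpos[of "1 + s"] by auto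
    have dF0: "(F0 has_real_derivative F0 s * d s) (at s)"
      unfolding F0_def d_def using np by (auto intro!: derivative_eq_intros simp: algebra_simps)
    have dd: "(d has_real_derivative P 1 s) (at s)"
      unfolding d_def P_def using np by (auto intro!: derivative_eq_intros)
    have dP: "(P k has_real_derivative P (Suc k) s) (at s)" for k
      unfolding P_def using np by (auto intro!: derivative_eq_intros)
    note [derivative_intros] = dF0 dd dP[of 1, simplified] dP[of 2, simplified]
    consider "j = 0" | "j = 1" | "j = 2" | "j = 3" using j by linarith
    then show ?thesis
      by cases (auto simp: F_def numeral_eq_Suc algebra_simps intro!: derivative_eq_intros dF0 dd dP)
  qed
  have val: "m j = F j 0" if "j \<le> 4" for j
    using power_series_eq_deriv[of 1 "\<lambda>j. m j / fact j" F j] sums deriv that by simp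
  \<comment> \<open>Because of the centring \<open>d 0\<close> vanishes; the second and third
    moments are then plain polygamma values, and the fourth acquires the extra term 3 (P 1
    0)^2.\<close>
  have d0: "F0 0 = 1" "d 0 = 0"
    by (simp_all add: F0_def d_def)
  have P0: "P 1 0 = pi\<^sup>2 / 6" "P 2 0 = - 2 * riemann_zeta 3" "P 3 0 = pi ^ 4 / 15"
    by (simp_all add: P_def Polygamma_at_1[simplified])
  show "m 1 = 0"
    using d0 by (simp add: val F_def)
  show "m 2 = pi\<^sup>2 / 6" "m 3 = - 2 * riemann_zeta 3"
    using d0 unfolding P0[symmetric] by (simp_all add: val F_def numeral_eq_Suc)
  have "m 4 = 3 * (P 1 0)\<^sup>2 + P 3 0"
    using d0 by (simp add: val F_def)
  then show "m 4 = 3 * pi ^ 4 / 20"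
    unfolding P0 by (simp add: power_divide)
qed

section \<open>Moments of a logarithm from the Laplace transform\<close>

lemma (in pair_sigma_finite) integrable_mult_fst_snd:
  fixes f :: "'a \<Rightarrow> real" and g :: "'b \<Rightarrow> real"
  assumes f: "integrable M1 f" and g: "integrable M2 g"
  shows "integrable (M1 \<Otimes>\<^sub>M M2) (\<lambda>z. f (fst z) * g (snd z))"
proof (rule Fubini_integrable)
  have [measurable]: "f \<in> borel_measurable M1" "g \<in> borel_measurable M2"
    using f g by auto
  show "(\<lambda>z. f (fst z) * g (snd z)) \<in> borel_measurable (M1 \<Otimes>\<^sub>M M2)"
    by measurable
qed (use f g in \<open>auto simp: abs_mult intro!: integrable_mult_left\<close>)

lemma (in pair_sigma_finite) integral_mult_fst_snd:
  fixes f :: "'a \<Rightarrow> real" and g :: "'b \<Rightarrow> real"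
  assumes f: "integrable M1 f" and g: "integrable M2 g"
  shows "(\<integral>z. f (fst z) * g (snd z) \<partial>(M1 \<Otimes>\<^sub>M M2)) = integral\<^sup>L M1 f * integral\<^sup>L M2 g"
  by (subst integral_fst'[OF integrable_mult_fst_snd[OF f g], symmetric]) simp

text \<open>Independence is encoded by the product measure, so each binomial term factorises. The
  expansion serves twice, for E against S and for E against E'.\<close>

lemma (in pair_sigma_finite) diff_moments:
  fixes U :: "'a \<Rightarrow> real" and V :: "'b \<Rightarrow> real"
  assumes U: "\<And>i. i \<le> k \<Longrightarrow> integrable M1 (\<lambda>x. U x ^ i)"
    and V: "\<And>i. i \<le> k \<Longrightarrow> integrable M2 (\<lambda>x. V x ^ i)"
  shows "integrable (M1 \<Otimes>\<^sub>M M2) (\<lambda>z. (U (fst z) - V (snd z)) ^ k)"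
    and "(\<integral>z. (U (fst z) - V (snd z)) ^ k \<partial>(M1 \<Otimes>\<^sub>M M2))
      = (\<Sum>i\<le>k. real (k choose i) * (-1) ^ (k - i) * (\<integral>x. U x ^ i \<partial>M1) * (\<integral>x. V x ^ (k - i) \<partial>M2))"
proof -
  have eq: "(U (fst z) - V (snd z)) ^ k
      = (\<Sum>i\<le>k. (real (k choose i) * (-1) ^ (k - i)) * (U (fst z) ^ i * V (snd z) ^ (k - i)))" for z
  proof -
    have "(U (fst z) + (- V (snd z))) ^ k
        = (\<Sum>i\<le>k. real (k choose i) * U (fst z) ^ i * (- V (snd z)) ^ (k - i))"
      by (rule binomial_ring)
    then show ?thesis
      by (simp add: power_minus[of "V (snd z)"] mult_ac)
  qed
  have int: "integrable (M1 \<Otimes>\<^sub>M M2) (\<lambda>z. U (fst z) ^ i * V (snd z) ^ (k - i))" if "i \<le> k" for i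
    using that by (intro integrable_mult_fst_snd U V) auto
  show "integrable (M1 \<Otimes>\<^sub>M M2) (\<lambda>z. (U (fst z) - V (snd z)) ^ k)"
    unfolding eq by (intro Bochner_Integration.integrable_sum integrable_mult_right int) auto
  show "(\<integral>z. (U (fst z) - V (snd z)) ^ k \<partial>(M1 \<Otimes>\<^sub>M M2))
      = (\<Sum>i\<le>k. real (k choose i) * (-1) ^ (k - i) * (\<integral>x. U x ^ i \<partial>M1) * (\<integral>x. V x ^ (k - i) \<partial>M2))"
    unfolding eq
  proof (subst Bochner_Integration.integral_sum)
    show "(\<Sum>i\<le>k. \<integral>z. real (k choose i) * (-1) ^ (k - i) * (U (fst z) ^ i * V (snd z) ^ (k - i)) \<partial>(M1 \<Otimes>\<^sub>M M2))
        = (\<Sum>i\<le>k. real (k choose i) * (-1) ^ (k - i) * (\<integral>x. U x ^ i \<partial>M1) * (\<integral>x. V x ^ (k - i) \<partial>M2))"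
    proof (rule sum.cong[OF refl])
      fix i assume "i \<in> {..k}"
      then show "(\<integral>z. real (k choose i) * (-1) ^ (k - i) * (U (fst z) ^ i * V (snd z) ^ (k - i)) \<partial>(M1 \<Otimes>\<^sub>M M2))
          = real (k choose i) * (-1) ^ (k - i) * (\<integral>x. U x ^ i \<partial>M1) * (\<integral>x. V x ^ (k - i) \<partial>M2)"
        by (simp only: integral_mult_right_zero) (subst integral_mult_fst_snd, auto intro: U V)
    qed
  qed (intro integrable_mult_right int, simp)
qed

lemma std_exponential_tail:
  assumes "a \<ge> 0"
  shows "emeasure std_exponential {x. a < x} = ennreal (exp (- a))"
proof -
  interpret prob_space std_exponential by (rule prob_space_std_exponential)
  have "distributed std_exponential lborel (\<lambda>x. x) (exponential_density 1)"
    unfolding distributed_def std_exponential_def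
    by (auto simp: distr_id2)
  from exponential_distributedD_gt[OF this assms] show ?thesis
    by (simp add: emeasure_eq_measure)
qed

text \<open>Exponential tilting turns the density of rate 1 into 1 / (1 + \<xi>) times the density
  of rate 1 + \<xi>. The result is the Mittag-Leffler transform with \<alpha> = \<theta> =
  1.\<close>

lemma std_exponential_laplace:
  assumes "\<xi> > 0"
  shows "(\<integral>x. exp (- \<xi> * x) \<partial>std_exponential) = 1 / (1 + \<xi>)"
proof -
  interpret E: prob_space "density lborel (exponential_density (1 + \<xi>))"
    by (rule prob_space_exponential_density) (use assms in auto)
  have "(\<integral>\<^sup>+x. ennreal (exp (- \<xi> * x)) \<partial>std_exponential)
      = (\<integral>\<^sup>+x. ennreal (exponential_density 1 x) * ennreal (exp (- \<xi> * x)) \<partial>lborel)"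
    unfolding std_exponential_def by (subst nn_integral_density) auto
  also have "\<dots> = (\<integral>\<^sup>+x. ennreal (1 / (1 + \<xi>)) * ennreal (exponential_density (1 + \<xi>) x) \<partial>lborel)"
  proof (intro nn_integral_cong)
    fix x :: real
    have "exp (- x) * exp (- \<xi> * x) = 1 / (1 + \<xi>) * ((1 + \<xi>) * exp (- x * (1 + \<xi>)))"
    proof -
      have "exp (- x) * exp (- \<xi> * x) = exp (- x * (1 + \<xi>))"
        by (simp add: mult_exp_exp algebra_simps)
      moreover have "1 / (1 + \<xi>) * ((1 + \<xi>) * c) = c" for c
        using assms by simp
      ultimately show ?thesis by simp
    qed
    then show "ennreal (exponential_density 1 x) * ennreal (exp (- \<xi> * x))
        = ennreal (1 / (1 + \<xi>)) * ennreal (exponential_density (1 + \<xi>) x)"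
      using assms by (auto simp: exponential_density_def simp flip: ennreal_mult')
  qed
  also have "\<dots> = ennreal (1 / (1 + \<xi>)) * emeasure (density lborel (exponential_density (1 + \<xi>))) UNIV"
    by (subst nn_integral_cmult) (auto simp: emeasure_density)
  also have "\<dots> = ennreal (1 / (1 + \<xi>))"
    using E.emeasure_space_1 by simp
  finally show ?thesis
    using assms by (subst (asm) nn_integral_eq_integrable) auto
qed

text \<open>
  If \<open>E\<close> is exponential and independent of \<open>X\<close>, then \<open>P(E > \<kappa> X)\<close> is the Laplace transform
  of \<open>X\<close> at \<open>\<kappa>\<close>; for a Mittag-Leffler variable this makes \<open>ln (E / X)\<close> logistic up to scaling.
\<close>

lemma log_ratio_logistic:
  assumes Q: "prob_space Q" and sets_Q [measurable_cong]: "sets Q = sets borel"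
    and pos: "AE x in Q. x > (0::real)" and "\<alpha> > 0" "\<theta> > 0"
    and laplace: "\<And>\<xi>. \<xi> > 0 \<Longrightarrow> (\<integral>x. exp (- \<xi> * x) \<partial>Q) = \<theta> / (\<theta> + \<xi> powr \<alpha>)"
  shows "emeasure (std_exponential \<Otimes>\<^sub>M Q) {z. y < \<alpha> * (ln (fst z) - ln (snd z)) - ln \<theta>}
    = ennreal (1 / (1 + exp y))"
proof -
  interpret Q: prob_space Q by fact
  interpret N: prob_space std_exponential by (rule prob_space_std_exponential)
  interpret pair_sigma_finite std_exponential Q ..
  \<comment> \<open>Solving y < \<alpha> (ln e - ln s) - ln \<theta> for e gives e > \<kappa> s.
    Moreover \<kappa> powr \<alpha> = \<theta> exp y, so the transform at \<kappa> becomes 1 / (1 +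
    exp y).\<close>
  define \<kappa> where "\<kappa> = exp ((y + ln \<theta>) / \<alpha>)"
  have "\<kappa> > 0" by (simp add: \<kappa>_def)
  define A where "A = {z::real \<times> real. y < \<alpha> * (ln (fst z) - ln (snd z)) - ln \<theta>}"
  have A: "A \<in> sets (std_exponential \<Otimes>\<^sub>M Q)"
  proof -
    have "Measurable.pred (std_exponential \<Otimes>\<^sub>M Q) (\<lambda>z. y < \<alpha> * (ln (fst z) - ln (snd z)) - ln \<theta>)"
      by measurable
    then show ?thesis
      by (simp add: pred_def A_def space_pair_measure sets_eq_imp_space_eq[OF sets_Q])
  qed
  have slice: "emeasure std_exponential ((\<lambda>x. (x, s)) -` A) = ennreal (exp (- \<kappa> * s))" if "s > 0" for s
  proof -
    have eq: "(e, s) \<in> A \<longleftrightarrow> \<kappa> * s < e" if "e > 0" for e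
    proof -
      have "(e, s) \<in> A \<longleftrightarrow> (y + ln \<theta>) / \<alpha> + ln s < ln e"
        using \<open>\<alpha> > 0\<close> by (simp add: A_def field_simps)
      also have "\<dots> \<longleftrightarrow> ln (\<kappa> * s) < ln e"
        using \<open>s > 0\<close> \<open>\<kappa> > 0\<close> by (simp add: \<kappa>_def ln_mult)
      also have "\<dots> \<longleftrightarrow> \<kappa> * s < e"
        using \<open>s > 0\<close> \<open>\<kappa> > 0\<close> that by simp
      finally show ?thesis .
    qed
    have "emeasure std_exponential ((\<lambda>x. (x, s)) -` A) = emeasure std_exponential {x. \<kappa> * s < x}"
    proof (rule emeasure_eq_AE)
      show "AE x in std_exponential. x \<in> (\<lambda>x. (x, s)) -` A \<longleftrightarrow> x \<in> {x. \<kappa> * s < x}"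
        using AE_std_exponential_pos by eventually_elim (simp add: eq)
      show "(\<lambda>x. (x, s)) -` A \<in> sets std_exponential"
        using sets_Pair2[OF A, of s] .
    qed simp
    also have "\<dots> = ennreal (exp (- \<kappa> * s))"
      using \<open>s > 0\<close> \<open>\<kappa> > 0\<close> by (subst std_exponential_tail) auto
    finally show ?thesis .
  qed
  have "\<kappa> powr \<alpha> = \<theta> * exp y"
    using \<open>\<alpha> > 0\<close> \<open>\<theta> > 0\<close> by (simp add: \<kappa>_def powr_def exp_add mult.commute)
  have int: "integrable Q (\<lambda>x. exp (- \<kappa> * x))"
  proof (rule Q.integrable_const_bound[where B=1])
    show "AE x in Q. norm (exp (- \<kappa> * x)) \<le> 1"
      using pos by eventually_elim (use \<open>\<kappa> > 0\<close> in auto)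
  qed measurable
  have "emeasure (std_exponential \<Otimes>\<^sub>M Q) A = (\<integral>\<^sup>+s. emeasure std_exponential ((\<lambda>x. (x, s)) -` A) \<partial>Q)"
    by (rule emeasure_pair_measure_alt2[OF A])
  also have "\<dots> = (\<integral>\<^sup>+s. ennreal (exp (- \<kappa> * s)) \<partial>Q)"
    using pos slice by (intro nn_integral_cong_AE) (auto elim!: eventually_mono)
  also have "\<dots> = ennreal (\<integral>s. exp (- \<kappa> * s) \<partial>Q)"
    by (rule nn_integral_eq_integral[OF int]) auto
  also have "\<dots> = ennreal (\<theta> / (\<theta> + \<kappa> powr \<alpha>))"
    using \<open>\<kappa> > 0\<close> by (simp only: laplace)
  also have "\<theta> / (\<theta> + \<kappa> powr \<alpha>) = 1 / (1 + exp y)"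
    unfolding \<open>\<kappa> powr \<alpha> = \<theta> * exp y\<close> using \<open>\<theta> > 0\<close>
    by (simp add: divide_simps add_pos_pos[THEN less_imp_neq, THEN not_sym]) (simp add: algebra_simps)
  finally show ?thesis
    unfolding A_def .
qed

text \<open>The tail in \<open>log_ratio_logistic\<close> depends on neither \<alpha> nor \<theta>,
  and the exponential law is the instance where both equal 1; hence the two distribution functions
  coincide.\<close>

lemma log_ratio_distr_eq:
  assumes Q: "prob_space Q" and sets_Q [measurable_cong]: "sets Q = sets borel"
    and pos: "AE x in Q. x > (0::real)" and "\<alpha> > 0" "\<theta> > 0"
    and laplace: "\<And>\<xi>. \<xi> > 0 \<Longrightarrow> (\<integral>x. exp (- \<xi> * x) \<partial>Q) = \<theta> / (\<theta> + \<xi> powr \<alpha>)"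
  shows "distr (std_exponential \<Otimes>\<^sub>M Q) borel (\<lambda>z. \<alpha> * (ln (fst z) - ln (snd z)) - ln \<theta>)
    = distr (std_exponential \<Otimes>\<^sub>M std_exponential) borel (\<lambda>z. ln (fst z) - ln (snd z))"
proof (rule cdf_unique)
  interpret Q: prob_space Q by fact
  interpret N: prob_space std_exponential by (rule prob_space_std_exponential)
  interpret NQ: pair_prob_space std_exponential Q ..
  interpret NN: pair_prob_space std_exponential std_exponential ..
  have cdf_eq: "cdf (distr (std_exponential \<Otimes>\<^sub>M R) borel (\<lambda>z. a * (ln (fst z) - ln (snd z)) - ln t)) y
      = 1 - 1 / (1 + exp y)"
    if R: "prob_space R" and sets_R [measurable_cong]: "sets R = sets borel"
      and "AE x in R. x > (0::real)" "a > 0" "t > 0"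
      and "\<And>\<xi>. \<xi> > 0 \<Longrightarrow> (\<integral>x. exp (- \<xi> * x) \<partial>R) = t / (t + \<xi> powr a)" for R a t y
  proof -
    interpret R: prob_space R by fact
    interpret NR: pair_prob_space std_exponential R ..
    let ?f = "\<lambda>z. a * (ln (fst z) - ln (snd z)) - ln t"
    have [measurable]: "?f \<in> borel_measurable (std_exponential \<Otimes>\<^sub>M R)"
      by measurable
    interpret D: prob_space "distr (std_exponential \<Otimes>\<^sub>M R) borel ?f"
      by (rule NR.prob_space_distr) simp
    have "emeasure (distr (std_exponential \<Otimes>\<^sub>M R) borel ?f) {y<..} = ennreal (1 / (1 + exp y))"
      using log_ratio_logistic[OF that, of y]
      by (subst emeasure_distr)
         (auto simp: vimage_def space_pair_measure sets_eq_imp_space_eq[OF sets_R])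
    then have "measure (distr (std_exponential \<Otimes>\<^sub>M R) borel ?f) {y<..} = 1 / (1 + exp y)"
      by (simp add: D.emeasure_eq_measure add_nonneg_pos)
    moreover have "measure (distr (std_exponential \<Otimes>\<^sub>M R) borel ?f) {..y}
        = 1 - measure (distr (std_exponential \<Otimes>\<^sub>M R) borel ?f) {y<..}"
      using D.prob_compl[of "{y<..}"] by (simp add: Compl_eq_Diff_UNIV[symmetric])
    ultimately show ?thesis
      by (simp add: cdf_def)
  qed
  show "real_distribution (distr (std_exponential \<Otimes>\<^sub>M Q) borel (\<lambda>z. \<alpha> * (ln (fst z) - ln (snd z)) - ln \<theta>))"
    by (rule NQ.real_distribution_distr) measurable
  show "real_distribution (distr (std_exponential \<Otimes>\<^sub>M std_exponential) borel (\<lambda>z. ln (fst z) - ln (snd z)))"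
    by (rule NN.real_distribution_distr) measurable
  show "cdf (distr (std_exponential \<Otimes>\<^sub>M Q) borel (\<lambda>z. \<alpha> * (ln (fst z) - ln (snd z)) - ln \<theta>))
    = cdf (distr (std_exponential \<Otimes>\<^sub>M std_exponential) borel (\<lambda>z. ln (fst z) - ln (snd z)))"
    using cdf_eq[OF assms]
      cdf_eq[OF prob_space_std_exponential sets_std_exponential AE_std_exponential_pos, of 1 1]
      std_exponential_laplace
    by (auto simp: fun_eq_iff)
qed

text \<open>The shifts absorb ln \<theta> and Euler's constant, so that \<alpha> (Y - T) and Y - Y'
  have the same law, Y being the centred ln E. Comparing moments of order k gives a triangular
  system: each equation determines the k-th moment of T from lower ones.\<close>

lemma log_moments:
  fixes \<alpha> \<theta> :: real
  assumes Q: "prob_space Q" and sets_Q [measurable_cong]: "sets Q = sets borel"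
    and pos: "AE x in Q. x > (0::real)" and \<alpha>: "\<alpha> > 0" and \<theta>: "\<theta> > 0"
    and laplace: "\<And>\<xi>. \<xi> > 0 \<Longrightarrow> (\<integral>x. exp (- \<xi> * x) \<partial>Q) = \<theta> / (\<theta> + \<xi> powr \<alpha>)"
  defines "T \<equiv> \<lambda>x. ln x + ln \<theta> / \<alpha> + euler_mascheroni"
  shows "\<And>j. j \<le> 4 \<Longrightarrow> integrable Q (\<lambda>x. T x ^ j)"
    and "(\<integral>x. T x \<partial>Q) = 0"
    and "(\<integral>x. T x ^ 2 \<partial>Q) = pi\<^sup>2 / (3 * \<alpha>\<^sup>2) - pi\<^sup>2 / 6"
    and "(\<integral>x. T x ^ 3 \<partial>Q) = - 2 * riemann_zeta 3"
    and "\<alpha> ^ 4 * (\<integral>x. T x ^ 4 \<partial>Q) = 7 * pi ^ 4 / 15 - \<alpha> ^ 4 * (3 * pi ^ 4 / 20)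
      - \<alpha> ^ 4 * pi\<^sup>2 * (pi\<^sup>2 / (3 * \<alpha>\<^sup>2) - pi\<^sup>2 / 6)"
proof -
  interpret Q: prob_space Q by fact
  interpret N: prob_space std_exponential by (rule prob_space_std_exponential)
  interpret NQ: pair_prob_space std_exponential Q ..
  interpret NN: pair_prob_space std_exponential std_exponential ..
  define Y where "Y = (\<lambda>x::real. ln x + euler_mascheroni)"
  have [measurable]: "Y \<in> borel_measurable borel" "T \<in> borel_measurable borel"
    unfolding Y_def T_def by measurable
  have Y: "integrable std_exponential (\<lambda>x. Y x ^ j)" for j
    unfolding Y_def by (rule log_exponential_moments)
  have law: "distr (std_exponential \<Otimes>\<^sub>M Q) borel (\<lambda>z. \<alpha> * (Y (fst z) - T (snd z)))
    = distr (std_exponential \<Otimes>\<^sub>M std_exponential) borel (\<lambda>z. Y (fst z) - Y (snd z))"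
    using log_ratio_distr_eq[OF assms(1-6)] \<alpha> by (simp add: Y_def T_def algebra_simps)
  have moment_law: "integrable (std_exponential \<Otimes>\<^sub>M Q) (\<lambda>z. (Y (fst z) - T (snd z)) ^ j) \<and>
      \<alpha> ^ j * (\<integral>z. (Y (fst z) - T (snd z)) ^ j \<partial>(std_exponential \<Otimes>\<^sub>M Q))
      = (\<integral>z. (Y (fst z) - Y (snd z)) ^ j \<partial>(std_exponential \<Otimes>\<^sub>M std_exponential))" for j
  proof -
    have "integrable (distr (std_exponential \<Otimes>\<^sub>M std_exponential) borel (\<lambda>z. Y (fst z) - Y (snd z))) (\<lambda>x. x ^ j)"
      by (subst integrable_distr_eq) (auto intro!: NN.diff_moments Y)
    then have "integrable (std_exponential \<Otimes>\<^sub>M Q) (\<lambda>z. (\<alpha> * (Y (fst z) - T (snd z))) ^ j)"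
      unfolding law[symmetric] by (subst (asm) integrable_distr_eq) auto
    then have 1: "integrable (std_exponential \<Otimes>\<^sub>M Q) (\<lambda>z. (Y (fst z) - T (snd z)) ^ j)"
      using \<alpha> by (simp add: power_mult_distrib)
    have "(\<integral>z. (\<alpha> * (Y (fst z) - T (snd z))) ^ j \<partial>(std_exponential \<Otimes>\<^sub>M Q))
        = (\<integral>x. x ^ j \<partial>distr (std_exponential \<Otimes>\<^sub>M Q) borel (\<lambda>z. \<alpha> * (Y (fst z) - T (snd z))))"
      by (subst integral_distr) auto
    also have "\<dots> = (\<integral>z. (Y (fst z) - Y (snd z)) ^ j \<partial>(std_exponential \<Otimes>\<^sub>M std_exponential))"
      unfolding law by (subst integral_distr) auto
    finally show ?thesis
      using 1 by (simp add: power_mult_distrib)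
  qed
  show T: "integrable Q (\<lambda>x. T x ^ j)" if "j \<le> 4" for j
  proof -
    \<comment> \<open>By Fubini (Y e - T)^4 is integrable in the second coordinate for almost every
      e, hence for some fixed e; this transfers integrability to the powers of T alone.\<close>
    have "AE e in std_exponential. integrable Q (\<lambda>s. (Y e - T s) ^ 4)"
      using NQ.AE_integrable_fst'[OF moment_law[of 4, THEN conjunct1]] by simp
    then obtain e where e: "integrable Q (\<lambda>s. (Y e - T s) ^ 4)"
      using eventually_happens'[OF N.ae_filter_bot] by blast
    show ?thesis
    proof (rule Bochner_Integration.integrable_bound)
      show "integrable Q (\<lambda>s. 1 + 8 * ((Y e - T s) ^ 4 + Y e ^ 4))"
        using e by auto
      show "AE s in Q. norm (T s ^ j) \<le> norm (1 + 8 * ((Y e - T s) ^ 4 + Y e ^ 4))"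
      proof (rule AE_I2)
        fix s
        \<comment> \<open>Applied twice, this gives (a + b)^4 <= 8 (a^4 + b^4), the source of the
          factor 8.\<close>
        have sq: "(a + b)\<^sup>2 \<le> 2 * (a\<^sup>2 + b\<^sup>2)" for a b :: real
          using zero_le_power2[of "a - b"] by (simp add: power2_eq_square algebra_simps)
        have "\<bar>T s\<bar> ^ j \<le> 1 + \<bar>T s\<bar> ^ 4"
        proof (cases "\<bar>T s\<bar> \<le> 1")
          case True
          then show ?thesis
            by (intro order_trans[OF power_le_one]) auto
        next
          case False
          then have "\<bar>T s\<bar> ^ j \<le> \<bar>T s\<bar> ^ 4"
            using that by (intro power_increasing) auto
          then show ?thesis by simp
        qed
        also have "\<bar>T s\<bar> ^ 4 = (((T s - Y e) + Y e)\<^sup>2)\<^sup>2"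
          by simp
        also have "\<dots> \<le> (2 * ((T s - Y e)\<^sup>2 + (Y e)\<^sup>2))\<^sup>2"
          by (rule power_mono[OF sq]) simp
        also have "\<dots> = 4 * ((T s - Y e)\<^sup>2 + (Y e)\<^sup>2)\<^sup>2"
          by (simp only: power_mult_distrib) simp
        also have "\<dots> \<le> 4 * (2 * (((T s - Y e)\<^sup>2)\<^sup>2 + ((Y e)\<^sup>2)\<^sup>2))"
          by (rule mult_left_mono[OF sq]) simp
        also have "\<dots> = 8 * ((Y e - T s) ^ 4 + Y e ^ 4)"
          by (simp add: power2_commute[of "T s"] flip: power_mult)
        finally show "norm (T s ^ j) \<le> norm (1 + 8 * ((Y e - T s) ^ 4 + Y e ^ 4))"
          by (simp add: power_abs)
      qed
    qed measurable
  qed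
  define m where "m = (\<lambda>j. \<integral>x. Y x ^ j \<partial>std_exponential)"
  define t where "t = (\<lambda>j. \<integral>x. T x ^ j \<partial>Q)"
  have m: "m 0 = 1" "m 1 = 0" "m 2 = pi\<^sup>2 / 6" "m 3 = - 2 * riemann_zeta 3" "m 4 = 3 * pi ^ 4 / 20"
    unfolding m_def Y_def using log_exponential_moments(2-5) N.prob_space by simp_all
  have t0: "t 0 = 1"
    unfolding t_def using Q.prob_space by simp
  have rel: "\<alpha> ^ k * (\<Sum>i\<le>k. real (k choose i) * (-1) ^ (k - i) * m i * t (k - i))
      = (\<Sum>i\<le>k. real (k choose i) * (-1) ^ (k - i) * m i * m (k - i))" if "k \<le> 4" for k
    using NQ.diff_moments(2)[of k Y T] NN.diff_moments(2)[of k Y Y] moment_law[of k] Y T that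
    by (simp add: m_def t_def)
  have 1: "t 1 = 0"
    using rel[of 1] \<alpha> m t0 by simp
  have 2: "\<alpha>\<^sup>2 * (m 2 + t 2) = 2 * m 2"
    using rel[of 2] m(1,2) t0 1 by (simp add: numeral_eq_Suc algebra_simps)
  \<comment> \<open>Y - Y' is symmetric, so its third moment is 0, and T inherits the third moment
    of Y whatever \<alpha> and \<theta> are.\<close>
  have 3: "\<alpha> ^ 3 * (m 3 - t 3) = 0"
    using rel[of 3] m(1,2) t0 1 by (simp add: numeral_eq_Suc algebra_simps)
  have 4: "\<alpha> ^ 4 * (m 4 + 6 * m 2 * t 2 + t 4) = 2 * m 4 + 6 * (m 2)\<^sup>2"
    using rel[of 4] m(1,2) t0 1 by (simp add: numeral_eq_Suc algebra_simps)
  show "(\<integral>x. T x \<partial>Q) = 0"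
    using 1 by (simp add: t_def)
  have t2: "t 2 = pi\<^sup>2 / (3 * \<alpha>\<^sup>2) - pi\<^sup>2 / 6"
    using 2 \<alpha> unfolding m by (simp add: field_simps)
  then show "(\<integral>x. T x ^ 2 \<partial>Q) = pi\<^sup>2 / (3 * \<alpha>\<^sup>2) - pi\<^sup>2 / 6"
    by (simp add: t_def)
  show "(\<integral>x. T x ^ 3 \<partial>Q) = - 2 * riemann_zeta 3"
    using 3 \<alpha> m by (simp add: t_def)
  have "\<alpha> ^ 4 * t 4 = 2 * m 4 + 6 * (m 2)\<^sup>2 - \<alpha> ^ 4 * m 4 - \<alpha> ^ 4 * (6 * m 2) * t 2"
    using 4 by (simp add: algebra_simps)
  \<comment> \<open>Here 7 pi^4 / 15 = 2 m 4 + 6 (m 2)^2 is the fourth moment of the standard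
    logistic law, and pi^2 = 6 m 2.\<close>
  also have "\<dots> = 7 * pi ^ 4 / 15 - \<alpha> ^ 4 * (3 * pi ^ 4 / 20)
      - \<alpha> ^ 4 * pi\<^sup>2 * (pi\<^sup>2 / (3 * \<alpha>\<^sup>2) - pi\<^sup>2 / 6)"
    unfolding t2 m by (simp add: power_divide)
  finally show "\<alpha> ^ 4 * (\<integral>x. T x ^ 4 \<partial>Q) = 7 * pi ^ 4 / 15 - \<alpha> ^ 4 * (3 * pi ^ 4 / 20)
      - \<alpha> ^ 4 * pi\<^sup>2 * (pi\<^sup>2 / (3 * \<alpha>\<^sup>2) - pi\<^sup>2 / 6)"
    by (simp add: t_def)
qed

section \<open>The Laplace transform of the Mittag-Leffler density\<close>

text \<open>The kernel of fractional integration of order b, extended by 0 so that convolutions and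
  transforms are integrals over the whole line.\<close>

definition riemann_liouville :: "real \<Rightarrow> real \<Rightarrow> real" where
  "riemann_liouville b t = (if t > 0 then t powr (b - 1) / Gamma b else 0)"

lemma riemann_liouville_nonneg: "b > 0 \<Longrightarrow> riemann_liouville b t \<ge> 0"
  by (simp add: riemann_liouville_def less_imp_le[OF Gamma_real_pos])

lemma borel_measurable_riemann_liouville [measurable]: "riemann_liouville b \<in> borel_measurable borel"
  unfolding riemann_liouville_def by measurable

lemma riemann_liouville_laplace:
  assumes "b > 0" "\<xi> > 0"
  shows "(\<integral>\<^sup>+t. ennreal (exp (- \<xi> * t)) * ennreal (riemann_liouville b t) \<partial>lborel) = ennreal (\<xi> powr (- b))"
proof -
  have G: "Gamma b > 0" "Gamma b \<noteq> 0"
    using Gamma_real_pos[OF assms(1)] by (safe, metis less_irrefl)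
  have "(\<integral>\<^sup>+t. ennreal (exp (- \<xi> * t)) * ennreal (riemann_liouville b t) \<partial>lborel)
      = ennreal (1 / \<xi>) * (\<integral>\<^sup>+t. ennreal (exp (- \<xi> * (0 + 1 / \<xi> * t))) * ennreal (riemann_liouville b (0 + 1 / \<xi> * t)) \<partial>lborel)"
    using assms by (subst nn_integral_real_affine[where c="1 / \<xi>" and t=0]) auto
  also have "\<dots> = ennreal (1 / \<xi>) * (\<integral>\<^sup>+t. ennreal (\<xi> powr (1 - b) / Gamma b)
      * ennreal (indicator {0..} t * t powr (b - 1) / exp t) \<partial>lborel)"
  proof (intro arg_cong2[where f="(*)"] refl nn_integral_cong_AE)
    have "AE t in lborel. t \<noteq> (0::real)" by (rule AE_lborel_singleton)
    then show "AE t in lborel. ennreal (exp (- \<xi> * (0 + 1 / \<xi> * t))) * ennreal (riemann_liouville b (0 + 1 / \<xi> * t))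
        = ennreal (\<xi> powr (1 - b) / Gamma b) * ennreal (indicator {0..} t * t powr (b - 1) / exp t)"
    proof eventually_elim
      case (elim t)
      show ?case
      proof (cases "t > 0")
        case True
        have "(t / \<xi>) powr (b - 1) = t powr (b - 1) * \<xi> powr (1 - b)"
          using True assms by (simp add: powr_divide powr_diff field_simps)
        then show ?thesis
          using True assms G by (simp add: riemann_liouville_def exp_minus field_simps flip: ennreal_mult')
      next
        case False
        then show ?thesis
          using elim assms by (auto simp: riemann_liouville_def zero_less_divide_iff)
      qed
    qed
  qed
  also have "\<dots> = ennreal (1 / \<xi>) * (ennreal (\<xi> powr (1 - b) / Gamma b) * ennreal (Gamma b))"
    using assms by (subst nn_integral_cmult) (auto simp: Gamma_conv_nn_integral_real)
  also have "\<dots> = ennreal (1 / \<xi> * (\<xi> powr (1 - b) / Gamma b * Gamma b))"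
    using assms G by (simp flip: ennreal_mult' ennreal_mult)
  also have "1 / \<xi> * (\<xi> powr (1 - b) / Gamma b * Gamma b) = \<xi> powr (- b)"
    using assms G by (simp add: powr_diff powr_minus field_simps)
  finally show ?thesis .
qed

text \<open>Semigroup law of fractional integration: rescaling s = t u leaves a Beta integral, whose
  value in terms of Gamma turns the normalisation into that of order a + b.\<close>

lemma riemann_liouville_convolution:
  assumes "a > 0" "b > 0"
  shows "(\<integral>\<^sup>+s. ennreal (riemann_liouville a (t - s)) * ennreal (riemann_liouville b s) \<partial>lborel) = ennreal (riemann_liouville (a + b) t)"
proof (cases "t > 0")
  case False
  then have "ennreal (riemann_liouville a (t - s)) * ennreal (riemann_liouville b s) = 0" for s
    by (auto simp: riemann_liouville_def)
  then show ?thesis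
    using False by (simp only: nn_integral_const mult_zero_left) (simp add: riemann_liouville_def)
next
  case t: True
  have G: "Gamma a > 0" "Gamma b > 0" "Gamma (a + b) > 0"
    using assms by (auto intro!: Gamma_real_pos)
  have "((\<lambda>u. u powr (b - 1) * (1 - u) powr (a - 1)) has_integral Beta b a) {0<..<1}"
    using has_integral_Beta_real[OF assms(2,1)] by (simp add: has_integral_Icc_iff_Ioo)
  then have beta: "(\<integral>\<^sup>+u. ennreal (indicator {0<..<1} u * (u powr (b - 1) * (1 - u) powr (a - 1))) \<partial>lborel) = ennreal (Beta b a)"
    by (intro nn_integral_has_integral_lebesgue) auto
  have "(\<integral>\<^sup>+s. ennreal (riemann_liouville a (t - s)) * ennreal (riemann_liouville b s) \<partial>lborel)
     = ennreal t * (\<integral>\<^sup>+u. ennreal (riemann_liouville a (t - (0 + t * u))) * ennreal (riemann_liouville b (0 + t * u)) \<partial>lborel)"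
    using t by (subst nn_integral_real_affine[where c=t and t=0]) auto
  also have "\<dots> = ennreal t * (\<integral>\<^sup>+u. ennreal (t powr (a + b - 2) / (Gamma a * Gamma b))
      * ennreal (indicator {0<..<1} u * (u powr (b - 1) * (1 - u) powr (a - 1))) \<partial>lborel)"
  proof (rule arg_cong[where f="\<lambda>x. ennreal t * x"], rule nn_integral_cong)
    fix u :: real
    have pos: "t - t * u > 0 \<longleftrightarrow> u < 1" "t * u > 0 \<longleftrightarrow> u > 0"
      using t by (auto simp: zero_less_mult_iff)
    show "ennreal (riemann_liouville a (t - (0 + t * u))) * ennreal (riemann_liouville b (0 + t * u))
        = ennreal (t powr (a + b - 2) / (Gamma a * Gamma b))
          * ennreal (indicator {0<..<1} u * (u powr (b - 1) * (1 - u) powr (a - 1)))"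
    proof (cases "0 < u \<and> u < 1")
      case True
      have "(t - t * u) powr (a - 1) = t powr (a - 1) * (1 - u) powr (a - 1)"
        using t True by (simp flip: powr_mult add: algebra_simps)
      moreover have "(t * u) powr (b - 1) = t powr (b - 1) * u powr (b - 1)"
        using t True by (simp add: powr_mult)
      moreover have "t powr (a - 1) * t powr (b - 1) = t powr (a + b - 2)"
        by (simp flip: powr_add add: algebra_simps)
      ultimately show ?thesis
        using True G t pos by (simp add: riemann_liouville_def flip: ennreal_mult' ennreal_mult)
    next
      case False
      then show ?thesis
        using pos by (auto simp: riemann_liouville_def)
    qed
  qed
  also have "\<dots> = ennreal t * (ennreal (t powr (a + b - 2) / (Gamma a * Gamma b)) * ennreal (Beta b a))"
    by (subst nn_integral_cmult) (auto simp: beta)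
  also have "\<dots> = ennreal (t * (t powr (a + b - 2) / (Gamma a * Gamma b) * Beta b a))"
    using t G by (simp add: Beta_def flip: ennreal_mult' ennreal_mult)
  also have "t * (t powr (a + b - 2) / (Gamma a * Gamma b) * Beta b a) = riemann_liouville (a + b) t"
  proof -
    have "t * t powr (a + b - 2) = t powr 1 * t powr (a + b - 2)"
      using t by simp
    also have "\<dots> = t powr (a + b - 1)"
      unfolding powr_add[symmetric] by (simp add: algebra_simps)
    finally have "t * t powr (a + b - 2) = t powr (a + b - 1)" .
    then show ?thesis
      using t G by (simp add: riemann_liouville_def Beta_def add.commute field_simps)
  qed
  finally show ?thesis .
qed

text \<open>Values in \<open>ennreal\<close> let Tonelli apply directly to this transform and to the
  convolution below; signed functions enter through their positive and negative parts.\<close>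

definition laplace_nn :: "(real \<Rightarrow> ennreal) \<Rightarrow> real \<Rightarrow> ennreal" where
  "laplace_nn h \<xi> = (\<integral>\<^sup>+t. ennreal (exp (- \<xi> * t)) * h t \<partial>lborel)"

definition conv_nn :: "(real \<Rightarrow> ennreal) \<Rightarrow> (real \<Rightarrow> ennreal) \<Rightarrow> real \<Rightarrow> ennreal" where
  "conv_nn k h t = (\<integral>\<^sup>+s. k (t - s) * h s \<partial>lborel)"

lemma borel_measurable_conv_nn [measurable]:
  assumes [measurable]: "k \<in> borel_measurable borel" "h \<in> borel_measurable borel"
  shows "conv_nn k h \<in> borel_measurable borel"
  unfolding conv_nn_def by measurable

text \<open>Tonelli and the translation t -> s + t, under which the exponential splits into a factor
  in s and a factor in t.\<close>

lemma laplace_conv_nn: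
  assumes [measurable]: "k \<in> borel_measurable borel" "h \<in> borel_measurable borel"
  shows "laplace_nn (conv_nn k h) \<xi> = laplace_nn k \<xi> * laplace_nn h \<xi>"
proof -
  have "laplace_nn (conv_nn k h) \<xi>
      = (\<integral>\<^sup>+t. \<integral>\<^sup>+s. ennreal (exp (- \<xi> * t)) * (k (t - s) * h s) \<partial>lborel \<partial>lborel)"
    unfolding laplace_nn_def conv_nn_def by (simp add: nn_integral_cmult)
  also have "\<dots> = (\<integral>\<^sup>+s. \<integral>\<^sup>+t. ennreal (exp (- \<xi> * t)) * (k (t - s) * h s) \<partial>lborel \<partial>lborel)"
    by (rule lborel_pair.Fubini'[symmetric]) simp
  also have "\<dots> = (\<integral>\<^sup>+s. laplace_nn k \<xi> * (ennreal (exp (- \<xi> * s)) * h s) \<partial>lborel)"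
  proof (rule nn_integral_cong)
    fix s
    have "(\<integral>\<^sup>+t. ennreal (exp (- \<xi> * t)) * (k (t - s) * h s) \<partial>lborel)
        = (\<integral>\<^sup>+t. ennreal (exp (- \<xi> * (s + 1 * t))) * (k (s + 1 * t - s) * h s) \<partial>lborel)"
      by (subst nn_integral_real_affine[where c=1 and t=s]) auto
    also have "\<dots> = (\<integral>\<^sup>+t. (ennreal (exp (- \<xi> * t)) * k t) * (ennreal (exp (- \<xi> * s)) * h s) \<partial>lborel)"
    proof (rule nn_integral_cong)
      fix t
      have "exp (- \<xi> * (s + 1 * t)) = exp (- \<xi> * t) * exp (- \<xi> * s)"
        by (simp add: algebra_simps mult_exp_exp)
      then show "ennreal (exp (- \<xi> * (s + 1 * t))) * (k (s + 1 * t - s) * h s)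
          = (ennreal (exp (- \<xi> * t)) * k t) * (ennreal (exp (- \<xi> * s)) * h s)"
        by (simp add: ennreal_mult' mult_ac)
    qed
    also have "\<dots> = laplace_nn k \<xi> * (ennreal (exp (- \<xi> * s)) * h s)"
      unfolding laplace_nn_def by (subst nn_integral_multc) auto
    finally show "(\<integral>\<^sup>+t. ennreal (exp (- \<xi> * t)) * (k (t - s) * h s) \<partial>lborel)
        = laplace_nn k \<xi> * (ennreal (exp (- \<xi> * s)) * h s)" .
  qed
  also have "\<dots> = laplace_nn k \<xi> * laplace_nn h \<xi>"
    unfolding laplace_nn_def by (subst nn_integral_cmult) auto
  finally show ?thesis .
qed

lemma borel_measurable_ml_density [measurable]: "ml_density \<alpha> \<theta> \<in> borel_measurable borel"
  unfolding ml_density_def mittag_leffler_def by measurable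

text \<open>
  The terms of the series of \<^term>\<open>ml_density \<alpha> \<theta>\<close> are the convolution powers of
  \<^term>\<open>\<lambda>t. \<theta> * riemann_liouville \<alpha> t\<close> with alternating signs. Splitting off the positive and the
  negative terms turns this into a Volterra equation between nonnegative functions.
\<close>

lemma ml_density_volterra:
  fixes \<alpha> \<theta> :: real
  assumes \<alpha>: "\<alpha> > 0" and \<theta>: "\<theta> > 0"
  defines "a \<equiv> \<lambda>t. ennreal (\<theta> * riemann_liouville \<alpha> t)"
    and "fp \<equiv> \<lambda>t. ennreal (ml_density \<alpha> \<theta> t)"
    and "fm \<equiv> \<lambda>t. ennreal (- ml_density \<alpha> \<theta> t)"
  shows "AE t in lborel. fp t + conv_nn a fp t = fm t + conv_nn a fm t + a t"
proof -
  \<comment> \<open>\<open>g r\<close> is the (r + 1)-fold convolution power of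
    \<open>a\<close>.\<close>
  define g where "g = (\<lambda>r t. \<theta> ^ Suc r * riemann_liouville (\<alpha> * real (Suc r)) t)"
  have g_nonneg: "g r t \<ge> 0" for r t
    unfolding g_def using \<alpha> \<theta> by (intro mult_nonneg_nonneg riemann_liouville_nonneg) auto
  have [measurable]: "g r \<in> borel_measurable borel" for r
    unfolding g_def by measurable
  have [measurable]: "a \<in> borel_measurable borel" "fp \<in> borel_measurable borel" "fm \<in> borel_measurable borel"
    unfolding a_def fp_def fm_def by measurable
  have conv_g: "(\<integral>\<^sup>+s. a (t - s) * ennreal (g r s) \<partial>lborel) = ennreal (g (Suc r) t)" for r t
  proof -
    have "(\<integral>\<^sup>+s. a (t - s) * ennreal (g r s) \<partial>lborel) = (\<integral>\<^sup>+s. ennreal (\<theta> ^ Suc (Suc r))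
        * (ennreal (riemann_liouville \<alpha> (t - s)) * ennreal (riemann_liouville (\<alpha> * real (Suc r)) s)) \<partial>lborel)"
      using \<theta> unfolding a_def g_def by (intro nn_integral_cong) (simp add: ennreal_mult' mult_ac)
    also have "\<dots> = ennreal (\<theta> ^ Suc (Suc r)) * ennreal (riemann_liouville (\<alpha> + \<alpha> * real (Suc r)) t)"
      using \<alpha> by (subst nn_integral_cmult) (auto simp: riemann_liouville_convolution)
    also have "\<dots> = ennreal (g (Suc r) t)"
      using \<theta> by (simp add: g_def ennreal_mult' algebra_simps)
    finally show ?thesis .
  qed
  define p where "p = (\<lambda>r t. if even r then g r t else 0)"
  define q where "q = (\<lambda>r t. if even r then 0 else g r t)"
  have [measurable]: "p r \<in> borel_measurable borel" "q r \<in> borel_measurable borel" for r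
    unfolding p_def q_def by measurable
  have pq_nonneg: "p r t \<ge> 0" "q r t \<ge> 0" for r t
    using g_nonneg by (auto simp: p_def q_def)
  define P where "P = (\<lambda>t. \<Sum>r. ennreal (p r t))"
  define Q where "Q = (\<lambda>t. \<Sum>r. ennreal (q r t))"
  have [measurable]: "P \<in> borel_measurable borel" "Q \<in> borel_measurable borel"
    unfolding P_def Q_def by measurable
  \<comment> \<open>Convolution with \<open>a\<close> raises the index by one and so exchanges the
    parities: \<open>P\<close> goes to \<open>Q\<close>, while \<open>Q\<close> goes to
    \<open>P\<close> without its leading term \<open>a\<close>.\<close>
  have conv_P: "conv_nn a P t = Q t" for t
  proof -
    have "conv_nn a P t = (\<Sum>r. \<integral>\<^sup>+s. a (t - s) * ennreal (p r s) \<partial>lborel)"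
      unfolding conv_nn_def P_def ennreal_suminf_cmult[symmetric] by (subst nn_integral_suminf) auto
    also have "\<dots> = (\<Sum>r. ennreal (q (r + 1) t))"
      by (intro suminf_cong) (auto simp: p_def q_def conv_g)
    also have "\<dots> = Q t"
      unfolding Q_def by (subst (2) suminf_offset[where i=1]) (auto simp: q_def)
    finally show ?thesis .
  qed
  have conv_Q: "conv_nn a Q t + a t = P t" for t
  proof -
    have "conv_nn a Q t = (\<Sum>r. \<integral>\<^sup>+s. a (t - s) * ennreal (q r s) \<partial>lborel)"
      unfolding conv_nn_def Q_def ennreal_suminf_cmult[symmetric] by (subst nn_integral_suminf) auto
    also have "\<dots> = (\<Sum>r. ennreal (p (r + 1) t))"
      by (intro suminf_cong) (auto simp: p_def q_def conv_g)
    finally show ?thesis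
      unfolding P_def by (subst suminf_offset[where i=1]) (auto simp: p_def g_def a_def)
  qed
  define G where "G = (\<lambda>t. \<Sum>r. ennreal (g r t))"
  have [measurable]: "G \<in> borel_measurable borel"
    unfolding G_def by measurable
  \<comment> \<open>The choice of \<xi> makes \<theta> times \<xi> powr (- \<alpha>) equal to 1 / 2,
    so the transforms of the \<open>g r\<close> form a convergent geometric series. A finite
    transform yields absolute convergence almost everywhere, in place of growth estimates for
    Gamma.\<close>
  have "AE t in lborel. G t < \<infinity>"
  proof -
    define \<xi> where "\<xi> = (2 * \<theta>) powr (1 / \<alpha>)"
    have \<xi>: "\<xi> > 0" "\<xi> powr (- \<alpha>) = 1 / (2 * \<theta>)"
      using \<alpha> \<theta> by (auto simp: \<xi>_def powr_powr powr_minus_divide)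
    have "(\<integral>\<^sup>+t. ennreal (exp (- \<xi> * t)) * G t \<partial>lborel)
        = (\<Sum>r. \<integral>\<^sup>+t. ennreal (exp (- \<xi> * t)) * ennreal (g r t) \<partial>lborel)"
      unfolding G_def ennreal_suminf_cmult[symmetric] by (subst nn_integral_suminf) auto
    also have "\<dots> = (\<Sum>r. ennreal ((1 / 2) ^ Suc r))"
    proof (rule suminf_cong)
      fix r
      have "(\<integral>\<^sup>+t. ennreal (exp (- \<xi> * t)) * ennreal (g r t) \<partial>lborel)
          = (\<integral>\<^sup>+t. ennreal (\<theta> ^ Suc r) * (ennreal (exp (- \<xi> * t)) * ennreal (riemann_liouville (\<alpha> * real (Suc r)) t)) \<partial>lborel)"
        using \<theta> unfolding g_def by (intro nn_integral_cong) (simp add: ennreal_mult' mult_ac)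
      also have "\<dots> = ennreal (\<theta> ^ Suc r) * ennreal (\<xi> powr (- (\<alpha> * real (Suc r))))"
        using \<alpha> \<xi> by (subst nn_integral_cmult, simp, subst riemann_liouville_laplace) auto
      also have "\<xi> powr (- (\<alpha> * real (Suc r))) = (\<xi> powr (- \<alpha>)) ^ Suc r"
        using \<xi>(1) by (subst powr_realpow[symmetric]) (auto simp: powr_powr)
      also have "ennreal (\<theta> ^ Suc r) * ennreal ((\<xi> powr (- \<alpha>)) ^ Suc r) = ennreal ((1 / 2) ^ Suc r)"
        unfolding \<xi>(2) using \<theta> by (subst ennreal_mult[symmetric]) (auto simp flip: power_mult_distrib)
      finally show "(\<integral>\<^sup>+t. ennreal (exp (- \<xi> * t)) * ennreal (g r t) \<partial>lborel) = ennreal ((1 / 2) ^ Suc r)" .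
    qed
    also have "\<dots> \<noteq> \<infinity>"
    proof -
      have "summable (\<lambda>r. (1 / 2 :: real) ^ Suc r)"
        by (subst summable_Suc_iff) (simp add: summable_geometric)
      then show ?thesis
        unfolding infinity_ennreal_def by (rule ennreal_suminf_neq_top) simp
    qed
    finally have "AE t in lborel. ennreal (exp (- \<xi> * t)) * G t \<noteq> \<infinity>"
      by (intro nn_integral_PInf_AE) auto
    then show ?thesis
      by eventually_elim (auto simp: ennreal_mult_eq_top_iff less_top)
  qed
  then have finite: "AE t in lborel. P t < \<infinity> \<and> Q t < \<infinity> \<and> fp t + Q t = fm t + P t"
  proof eventually_elim
    case (elim t)
    have sg: "summable (\<lambda>r. g r t)"
      using elim g_nonneg unfolding G_def by (intro summable_suminf_not_top) auto
    have sp: "summable (\<lambda>r. p r t)" and sq: "summable (\<lambda>r. q r t)"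
      by (rule summable_comparison_test'[OF sg, of 0]; use g_nonneg in \<open>simp add: p_def q_def\<close>)+
    have P: "P t = ennreal (\<Sum>r. p r t)" and Q: "Q t = ennreal (\<Sum>r. q r t)"
      unfolding P_def Q_def using pq_nonneg sp sq by (auto intro!: suminf_ennreal2)
    have "ml_density \<alpha> \<theta> t = (\<Sum>r. p r t) - (\<Sum>r. q r t)"
    proof (cases "t > 0")
      case True
      have trm: "\<theta> * t powr (\<alpha> - 1) * ((- \<theta> * t powr \<alpha>) ^ r / Gamma (\<alpha> * real r + \<alpha>)) = p r t - q r t" for r
      proof -
        have "(t powr \<alpha>) ^ r = t powr (\<alpha> * real r)"
          using True by (subst powr_realpow[symmetric]) (auto simp: powr_powr)
        then have "t powr (\<alpha> - 1) * (t powr \<alpha>) ^ r = t powr (\<alpha> * real (Suc r) - 1)"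
          by (simp flip: powr_add add: algebra_simps)
        moreover have "(- \<theta> * t powr \<alpha>) ^ r = (-1) ^ r * \<theta> ^ r * (t powr \<alpha>) ^ r"
          by (metis mult_minus1 power_mult_distrib)
        ultimately have "\<theta> * t powr (\<alpha> - 1) * ((- \<theta> * t powr \<alpha>) ^ r / Gamma (\<alpha> * real r + \<alpha>))
            = (-1) ^ r * (\<theta> ^ Suc r * (t powr (\<alpha> * real (Suc r) - 1) / Gamma (\<alpha> * real r + \<alpha>)))"
          by (simp add: mult_ac)
        also have "\<dots> = (-1) ^ r * g r t"
          using True by (simp add: g_def riemann_liouville_def algebra_simps)
        finally show ?thesis
          by (auto simp: p_def q_def)
      qed
      \<comment> \<open>\<open>mittag_leffler\<close> is a \<open>suminf\<close>, so a constant may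
        be moved into it only once its own series is known to converge; dividing by this nonzero
        factor shows that.\<close>
      have c: "\<theta> * t powr (\<alpha> - 1) \<noteq> 0"
        using \<theta> True by simp
      have "summable (\<lambda>r. \<theta> * t powr (\<alpha> - 1) * ((- \<theta> * t powr \<alpha>) ^ r / Gamma (\<alpha> * real r + \<alpha>)))"
        unfolding trm by (intro summable_diff sp sq)
      then have "summable (\<lambda>r. (- \<theta> * t powr \<alpha>) ^ r / Gamma (\<alpha> * real r + \<alpha>))"
        unfolding summable_cmult_iff using c by blast
      from suminf_mult[OF this, of "\<theta> * t powr (\<alpha> - 1)"] have "ml_density \<alpha> \<theta> t
          = (\<Sum>r. \<theta> * t powr (\<alpha> - 1) * ((- \<theta> * t powr \<alpha>) ^ r / Gamma (\<alpha> * real r + \<alpha>)))"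
        using True by (simp add: ml_density_def mittag_leffler_def)
      then show ?thesis
        unfolding trm by (simp add: suminf_diff[OF sp sq])
    next
      case False
      then have "p r t = 0" "q r t = 0" for r
        by (auto simp: p_def q_def g_def riemann_liouville_def)
      then show ?thesis
        using False by (simp add: ml_density_def)
    qed
    moreover have "(\<Sum>r. p r t) \<ge> 0" "(\<Sum>r. q r t) \<ge> 0"
      using pq_nonneg sp sq by (auto intro!: suminf_nonneg)
    \<comment> \<open>\<open>ennreal\<close> sends negative reals to 0, so \<open>fp\<close> and
      \<open>fm\<close> are the positive and negative parts, and fp - fm = P - Q is written without
      subtraction.\<close>
    ultimately have "fp t + Q t = fm t + P t"
      unfolding P Q fp_def fm_def
      by (cases "(\<Sum>r. p r t) \<le> (\<Sum>r. q r t)") (auto simp: ennreal_neg simp flip: ennreal_plus)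
    then show ?case
      unfolding P Q by simp
  qed
  have conv_add: "conv_nn a u t + conv_nn a v t = conv_nn a (\<lambda>s. u s + v s) t"
    if [measurable]: "u \<in> borel_measurable borel" "v \<in> borel_measurable borel" for u v t
    unfolding conv_nn_def by (subst nn_integral_add[symmetric]) (auto simp: distrib_left)
  have conv_eq: "conv_nn a fp t + conv_nn a Q t = conv_nn a fm t + conv_nn a P t" for t
  proof -
    have "conv_nn a (\<lambda>s. fp s + Q s) t = conv_nn a (\<lambda>s. fm s + P s) t"
      unfolding conv_nn_def by (rule nn_integral_cong_AE) (use finite in \<open>eventually_elim, simp\<close>)
    then show ?thesis by (simp add: conv_add)
  qed
  show ?thesis
    using finite
  proof eventually_elim
    case (elim t)
    \<comment> \<open>P t + Q t is added to bring in both recursions; its finiteness permits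
      cancelling it in \<open>ennreal\<close>.\<close>
    have "(P t + Q t) + (fp t + conv_nn a fp t) = (fp t + Q t) + (conv_nn a fp t + (conv_nn a Q t + a t))"
      unfolding conv_Q by (simp add: add_ac)
    also have "\<dots> = (fm t + P t) + ((conv_nn a fp t + conv_nn a Q t) + a t)"
      using elim by (simp add: add_ac)
    also have "\<dots> = (P t + Q t) + (fm t + conv_nn a fm t + a t)"
      unfolding conv_eq conv_P by (simp add: add_ac)
    finally show ?case
      using elim by (auto simp: ennreal_add_left_cancel)
  qed
qed

text \<open>
  A priori \<^term>\<open>ml_density \<alpha> \<theta>\<close> may take negative values, and the hypothesis only says that its
  positive part has integral 1. By the Volterra equation the transform of the negative part at
  \<open>x\<close> is at most \<open>x powr \<alpha> / \<theta>\<close>; letting \<open>x\<close> tend to 0 shows that it vanishes.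
\<close>

lemma ml_laplace:
  fixes \<alpha> \<theta> \<xi> :: real
  assumes \<alpha>: "\<alpha> > 0" and \<theta>: "\<theta> > 0" and "\<xi> > 0"
    and prob: "prob_space (density lborel (\<lambda>t. ennreal (ml_density \<alpha> \<theta> t)))"
  shows "(\<integral>t. exp (- \<xi> * t) \<partial>density lborel (\<lambda>t. ennreal (ml_density \<alpha> \<theta> t))) = \<theta> / (\<theta> + \<xi> powr \<alpha>)"
proof -
  define a where "a = (\<lambda>t. ennreal (\<theta> * riemann_liouville \<alpha> t))"
  define fp where "fp = (\<lambda>t. ennreal (ml_density \<alpha> \<theta> t))"
  define fm where "fm = (\<lambda>t. ennreal (- ml_density \<alpha> \<theta> t))"
  have [measurable]: "a \<in> borel_measurable borel" "fp \<in> borel_measurable borel" "fm \<in> borel_measurable borel"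
    unfolding a_def fp_def fm_def by measurable
  have supp: "fp t = 0" "fm t = 0" if "t \<le> 0" for t
    using that by (auto simp: fp_def fm_def ml_density_def)
  have L_a: "laplace_nn a x = ennreal (\<theta> * x powr (- \<alpha>))" if "x > 0" for x
  proof -
    have "laplace_nn a x = (\<integral>\<^sup>+t. ennreal \<theta> * (ennreal (exp (- x * t)) * ennreal (riemann_liouville \<alpha> t)) \<partial>lborel)"
      unfolding laplace_nn_def a_def using \<theta> by (intro nn_integral_cong) (simp add: ennreal_mult' mult_ac)
    also have "\<dots> = ennreal \<theta> * ennreal (x powr (- \<alpha>))"
      by (subst nn_integral_cmult, simp, subst riemann_liouville_laplace) (use \<alpha> that in auto)
    finally show ?thesis
      using \<theta> by (simp add: ennreal_mult')
  qed
  have L_fp_le: "laplace_nn fp x \<le> 1" if x: "x > 0" for x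
  proof -
    have "laplace_nn fp x \<le> (\<integral>\<^sup>+t. fp t \<partial>lborel)"
      unfolding laplace_nn_def
    proof (rule nn_integral_mono)
      fix t
      show "ennreal (exp (- x * t)) * fp t \<le> fp t"
      proof (cases "t \<le> 0")
        case False
        then have "ennreal (exp (- x * t)) \<le> 1"
          using x by simp
        then show ?thesis
          using mult_right_mono[of "ennreal (exp (- x * t))" 1 "fp t"] by simp
      qed (simp add: supp)
    qed
    also have "\<dots> = 1"
      using prob_space.emeasure_space_1[OF prob] by (simp add: emeasure_density fp_def)
    finally show ?thesis .
  qed
  have L_eq: "laplace_nn fp x + laplace_nn a x * laplace_nn fp x
      = laplace_nn fm x + laplace_nn a x * laplace_nn fm x + laplace_nn a x" for x
  proof -
    have "laplace_nn (\<lambda>t. fp t + conv_nn a fp t) x = laplace_nn (\<lambda>t. fm t + conv_nn a fm t + a t) x"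
      unfolding laplace_nn_def a_def fp_def fm_def
      using ml_density_volterra[OF \<alpha> \<theta>] by (intro nn_integral_cong_AE) (auto elim!: eventually_mono)
    moreover have "laplace_nn (\<lambda>t. u t + v t) x = laplace_nn u x + laplace_nn v x"
      if [measurable]: "u \<in> borel_measurable borel" "v \<in> borel_measurable borel" for u v
      unfolding laplace_nn_def by (subst nn_integral_add[symmetric]) (auto simp: distrib_left)
    ultimately show ?thesis
      by (simp add: laplace_conv_nn)
  qed
  \<comment> \<open>The transform of \<open>fp\<close> is at most 1 and controls that of
    \<open>fm\<close> through \<open>L_eq\<close>; both being finite, the equation can be solved for
    their difference in the reals.\<close>
  have bound: "\<exists>p m. laplace_nn fp x = ennreal p \<and> laplace_nn fm x = ennreal m
      \<and> 0 \<le> p \<and> p \<le> 1 \<and> 0 \<le> m \<and> p - m = \<theta> / (\<theta> + x powr \<alpha>)" if x: "x > 0" for x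
  proof -
    define c where "c = \<theta> * x powr (- \<alpha>)"
    have c: "c > 0" using \<theta> that by (simp add: c_def)
    obtain p where p: "laplace_nn fp x = ennreal p" "0 \<le> p" "p \<le> 1"
      using L_fp_le[OF x] by (cases "laplace_nn fp x") (auto simp: top_unique)
    have "laplace_nn fm x \<le> laplace_nn fp x + laplace_nn a x * laplace_nn fp x"
      unfolding L_eq by (simp add: add.assoc)
    also have "\<dots> = ennreal (p + c * p)"
      using p c by (simp add: L_a[OF x] c_def[symmetric] ennreal_mult')
    finally obtain m where m: "laplace_nn fm x = ennreal m" "0 \<le> m"
      by (cases "laplace_nn fm x") (auto simp: top_unique)
    have "p + c * p = m + c * m + c"
      using L_eq[of x] p m c by (simp add: L_a[OF x] c_def[symmetric] flip: ennreal_mult' ennreal_plus)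
    then have "(p - m) * (1 + c) = c" by (simp add: algebra_simps)
    then have "p - m = c / (1 + c)" using c by (simp add: field_simps)
    also have "c / (1 + c) = \<theta> / (\<theta> + x powr \<alpha>)"
      using \<theta> that by (simp add: c_def powr_minus divide_simps)
    finally show ?thesis using p m by blast
  qed
  have fm_0: "laplace_nn fm 1 = 0"
  proof -
    obtain m where m: "laplace_nn fm 1 = ennreal m" "0 \<le> m"
      using bound[of 1] by auto
    \<comment> \<open>As \<open>fm\<close> lives on t > 0, its transform decreases in the argument,
      so the value at 1 is at most the value at x, and p' <= 1 bounds the latter.\<close>
    have "m \<le> x powr \<alpha> / \<theta>" if x: "0 < x" "x < 1" for x
    proof -
      obtain p' m' where pm: "laplace_nn fm x = ennreal m'" "p' \<le> 1" "0 \<le> m'" "p' - m' = \<theta> / (\<theta> + x powr \<alpha>)"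
        using bound[OF x(1)] by blast
      have "laplace_nn fm 1 \<le> laplace_nn fm x"
        unfolding laplace_nn_def
      proof (rule nn_integral_mono)
        fix t
        show "ennreal (exp (- 1 * t)) * fm t \<le> ennreal (exp (- x * t)) * fm t"
          using x by (cases "t \<le> 0") (auto simp: supp intro!: mult_right_mono ennreal_leI)
      qed
      then have "m \<le> m'" using m pm by simp
      also have "m' \<le> 1 - \<theta> / (\<theta> + x powr \<alpha>)" using pm by linarith
      also have "\<dots> \<le> x powr \<alpha> / \<theta>"
      proof -
        have "\<theta> + x powr \<alpha> > 0" using \<theta> by (simp add: add_pos_nonneg)
        then show ?thesis using \<theta> by (simp add: field_simps)
      qed
      finally show ?thesis .
    qed
    then have "\<forall>\<^sub>F x in at_right 0. m \<le> x powr \<alpha> / \<theta>"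
      by (auto simp: eventually_at_right_field intro!: exI[of _ 1])
    moreover have "((\<lambda>x. x powr \<alpha> / \<theta>) \<longlongrightarrow> 0 / \<theta>) (at_right 0)"
      using \<alpha> \<theta> by (intro tendsto_divide tendsto_const) (real_asymp, simp)
    ultimately have "m \<le> 0"
      by (intro tendsto_lowerbound[of "\<lambda>x. x powr \<alpha> / \<theta>" 0 "at_right 0"]) auto
    then show ?thesis using m by simp
  qed
  \<comment> \<open>A single zero of the transform suffices: the integrand is nonnegative and the
    exponential is positive.\<close>
  then have "AE t in lborel. fm t = 0"
    unfolding laplace_nn_def by (subst (asm) nn_integral_0_iff_AE) auto
  then have "laplace_nn fm \<xi> = 0"
    unfolding laplace_nn_def by (subst nn_integral_0_iff_AE) (auto elim!: eventually_mono)
  with bound[OF \<open>\<xi> > 0\<close>] have "laplace_nn fp \<xi> = ennreal (\<theta> / (\<theta> + \<xi> powr \<alpha>))"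
    by auto
  moreover have "(\<integral>\<^sup>+t. ennreal (exp (- \<xi> * t)) \<partial>density lborel fp) = laplace_nn fp \<xi>"
    unfolding laplace_nn_def by (subst nn_integral_density) (auto simp: mult.commute)
  ultimately have "(\<integral>\<^sup>+t. ennreal (exp (- \<xi> * t)) \<partial>density lborel fp) = ennreal (\<theta> / (\<theta> + \<xi> powr \<alpha>))"
    by simp
  then show ?thesis
    unfolding fp_def using \<theta> by (subst (asm) nn_integral_eq_integrable) (auto intro!: divide_nonneg_nonneg add_nonneg_nonneg)
qed

lemma AE_ml_density_pos: "AE t in density lborel (\<lambda>t. ennreal (ml_density \<alpha> \<theta> t)). t > 0"
  by (subst AE_density, measurable) (auto simp: ml_density_def)

section \<open>Limit theorems\<close>

text \<open>The cross term between the new summand and the partial sum vanishes by independence.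
  Growth linear in n means that sample means deviate by O(1 / n) in mean square.\<close>

lemma (in prob_space) indep_sum_square_expectation:
  fixes X :: "nat \<Rightarrow> 'a \<Rightarrow> real"
  assumes indep: "indep_vars (\<lambda>_. borel) X UNIV"
    and mean: "\<And>k. expectation (X k) = 0"
    and sq: "\<And>k. integrable M (\<lambda>x. (X k x)\<^sup>2)"
    and var: "\<And>k. expectation (\<lambda>x. (X k x)\<^sup>2) = v"
  shows "integrable M (\<lambda>x. (\<Sum>k<n. X k x)\<^sup>2)" "expectation (\<lambda>x. (\<Sum>k<n. X k x)\<^sup>2) = real n * v"
proof -
  have [measurable]: "X k \<in> borel_measurable M" for k
    using indep unfolding indep_vars_def2 by simp
  have int: "integrable M (X k)" for k
    by (rule square_integrable_imp_integrable[OF _ sq]) simp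
  have "integrable M (\<lambda>x. (\<Sum>k<n. X k x)\<^sup>2) \<and> expectation (\<lambda>x. (\<Sum>k<n. X k x)\<^sup>2) = real n * v"
  proof (induction n)
    case (Suc n)
    define T where "T = (\<lambda>x. \<Sum>k<n. X k x)"
    have T: "integrable M T"
      unfolding T_def by (intro Bochner_Integration.integrable_sum int)
    have "indep_var borel (X n) borel T"
      unfolding T_def by (intro indep_vars_sum indep_vars_subset[OF indep]) auto
    then have "integrable M (\<lambda>x. X n x * T x)" "expectation (\<lambda>x. X n x * T x) = 0"
      using indep_var_lebesgue_integral[OF _ int T] indep_var_integrable[OF _ int T] mean by simp_all
    moreover have eq: "(\<Sum>k<Suc n. X k x)\<^sup>2 = (T x)\<^sup>2 + 2 * (X n x * T x) + (X n x)\<^sup>2" for x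
      by (simp add: T_def power2_eq_square algebra_simps)
    moreover have "integrable M (\<lambda>x. (T x)\<^sup>2)" "expectation (\<lambda>x. (T x)\<^sup>2) = real n * v"
      using Suc.IH by (simp_all add: T_def)
    ultimately show ?case
      unfolding eq using sq[of n] var[of n] by (simp add: distrib_right)
  qed simp
  then show "integrable M (\<lambda>x. (\<Sum>k<n. X k x)\<^sup>2)" "expectation (\<lambda>x. (\<Sum>k<n. X k x)\<^sup>2) = real n * v"
    by auto
qed

lemma char_distr:
  fixes f :: "'a \<Rightarrow> real"
  assumes "f \<in> borel_measurable M"
  shows "char (distr M borel f) t = (CLINT x|M. iexp (t * f x))"
  unfolding char_def by (subst integral_distr) (use assms in auto)

lemma char_normal:
  assumes "\<sigma> > 0"
  shows "char (density lborel (normal_density 0 \<sigma>)) t = complex_of_real (exp (- (\<sigma>\<^sup>2 * t\<^sup>2) / 2))"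
    and "real_distribution (density lborel (normal_density 0 \<sigma>))"
proof -
  interpret prob_space std_normal_distribution
    by (rule prob_space_normal_density) simp
  have "distributed std_normal_distribution lborel (\<lambda>x. 0 + \<sigma> * x) (normal_density (0 + \<sigma> * 0) (\<bar>\<sigma>\<bar> * 1))"
    by (rule normal_density_affine) (use assms in \<open>auto simp: distributed_def distr_id2\<close>)
  then have law: "distr std_normal_distribution borel (\<lambda>x. \<sigma> * x) = density lborel (normal_density 0 \<sigma>)"
    using assms by (simp add: distributed_def cong: distr_cong)
  have "char (density lborel (normal_density 0 \<sigma>)) t = char std_normal_distribution (\<sigma> * t)"
    unfolding law[symmetric] by (subst char_distr) (auto simp: char_def mult_ac)
  then show "char (density lborel (normal_density 0 \<sigma>)) t = complex_of_real (exp (- (\<sigma>\<^sup>2 * t\<^sup>2) / 2))"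
    by (simp add: char_std_normal_distribution power_mult_distrib)
  show "real_distribution (density lborel (normal_density 0 \<sigma>))"
    using prob_space_normal_density[OF assms, of 0]
    by (simp add: real_distribution_def real_distribution_axioms_def)
qed

text \<open>The central limit theorem in the form in which two independent sums combine by
  multiplication. The change of normalisation amounts to evaluating at sqrt v t.\<close>

lemma (in prob_space) char_scaled_sum_tendsto:
  fixes X :: "nat \<Rightarrow> 'a \<Rightarrow> real"
  assumes indep: "indep_vars (\<lambda>_. borel) X UNIV"
    and mean: "\<And>k. expectation (X k) = 0"
    and sq: "\<And>k. integrable M (\<lambda>x. (X k x)\<^sup>2)"
    and var: "\<And>k. expectation (\<lambda>x. (X k x)\<^sup>2) = v" and v: "v > 0"
    and distr: "\<And>k. distr M borel (X k) = \<mu>"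
  shows "(\<lambda>n. char (distr M borel (\<lambda>x. (\<Sum>k<n. X k x) / sqrt (real n))) t)
    \<longlonglongrightarrow> complex_of_real (exp (- (v * t\<^sup>2) / 2))"
proof -
  have [measurable]: "X k \<in> borel_measurable M" for k
    using indep unfolding indep_vars_def2 by simp
  have "weak_conv_m (\<lambda>n. distr M borel (\<lambda>x. (\<Sum>k<n. X k x) / sqrt (real n * (sqrt v)\<^sup>2))) std_normal_distribution"
    by (rule central_limit_theorem_zero_mean[OF indep mean _ sq _ distr]) (use v mean var in auto)
  then have "(\<lambda>n. char (distr M borel (\<lambda>x. (\<Sum>k<n. X k x) / sqrt (real n * (sqrt v)\<^sup>2))) (sqrt v * t))
      \<longlonglongrightarrow> char std_normal_distribution (sqrt v * t)"
    by (intro levy_continuity1 real_distribution_distr real_dist_normal_dist) auto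
  moreover have "char (distr M borel (\<lambda>x. (\<Sum>k<n. X k x) / sqrt (real n * (sqrt v)\<^sup>2))) (sqrt v * t)
      = char (distr M borel (\<lambda>x. (\<Sum>k<n. X k x) / sqrt (real n))) t" for n
  proof -
    have "sqrt v * t * (x / sqrt (real n * (sqrt v)\<^sup>2)) = t * (x / sqrt (real n))" for x
      using v by (simp add: real_sqrt_mult)
    then show ?thesis
      by (subst (1 2) char_distr) (simp, simp, simp only:)
  qed
  ultimately show ?thesis
    using v by (simp add: char_std_normal_distribution power_mult_distrib)
qed

text \<open>Slutsky's argument on characteristic functions: |exp (i t R) - 1| is at most |t|
  \<epsilon> where |R| < \<epsilon>, and at most 2 elsewhere.\<close>

lemma (in prob_space) weak_conv_m_add_negligible:
  fixes X R :: "nat \<Rightarrow> 'a \<Rightarrow> real"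
  assumes [measurable]: "\<And>n. X n \<in> borel_measurable M" "\<And>n. R n \<in> borel_measurable M"
    and \<mu>: "real_distribution \<mu>"
    and conv: "\<And>t. (\<lambda>n. char (distr M borel (X n)) t) \<longlonglongrightarrow> char \<mu> t"
    and negl: "\<And>\<epsilon>. \<epsilon> > 0 \<Longrightarrow> (\<lambda>n. prob {x \<in> space M. \<bar>R n x\<bar> \<ge> \<epsilon>}) \<longlonglongrightarrow> 0"
  shows "weak_conv_m (\<lambda>n. distr M borel (\<lambda>x. X n x + R n x)) \<mu>"
proof (rule levy_continuity[OF _ \<mu>])
  show "real_distribution (distr M borel (\<lambda>x. X n x + R n x))" for n
    by (rule real_distribution_distr) simp
  fix t :: real
  have "(\<lambda>n. char (distr M borel (\<lambda>x. X n x + R n x)) t - char (distr M borel (X n)) t) \<longlonglongrightarrow> 0"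
  proof (rule LIMSEQ_I)
    fix r :: real assume r: "r > 0"
    \<comment> \<open>The error r is split evenly: |t| \<epsilon> < r / 2, and an exceptional event
      of probability below r / 4 costs at most twice its probability.\<close>
    define \<epsilon> where "\<epsilon> = r / (2 * (\<bar>t\<bar> + 1))"
    have \<epsilon>: "\<epsilon> > 0" "\<bar>t\<bar> * \<epsilon> < r / 2"
      using r by (auto simp: \<epsilon>_def field_simps add_pos_nonneg)
    have "\<forall>\<^sub>F n in sequentially. prob {x \<in> space M. \<bar>R n x\<bar> \<ge> \<epsilon>} < r / 4"
      using order_tendstoD(2)[OF negl[OF \<epsilon>(1)], of "r / 4"] r by simp
    then obtain N where N: "\<And>n. n \<ge> N \<Longrightarrow> prob {x \<in> space M. \<bar>R n x\<bar> \<ge> \<epsilon>} < r / 4"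
      by (auto simp: eventually_sequentially)
    have "norm (char (distr M borel (\<lambda>x. X n x + R n x)) t - char (distr M borel (X n)) t - 0) < r" if "n \<ge> N" for n
    proof -
      define A where "A = {x \<in> space M. \<bar>R n x\<bar> \<ge> \<epsilon>}"
      have [measurable]: "A \<in> sets M" unfolding A_def by measurable
      have int: "complex_integrable M (\<lambda>x. iexp (t * f x))" if [measurable]: "f \<in> borel_measurable M" for f
        by (rule integrable_const_bound[where B=1]) auto
      have "char (distr M borel (\<lambda>x. X n x + R n x)) t - char (distr M borel (X n)) t
          = (CLINT x|M. iexp (t * (X n x + R n x)) - iexp (t * X n x))"
        by (subst Bochner_Integration.integral_diff[OF int int]) (simp_all only: char_distr assms borel_measurable_add)
      also have "norm \<dots> \<le> (\<integral>x. norm (iexp (t * (X n x + R n x)) - iexp (t * X n x)) \<partial>M)"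
        by (rule integral_norm_bound)
      also have "\<dots> \<le> (\<integral>x. \<bar>t\<bar> * \<epsilon> + 2 * indicator A x \<partial>M)"
      proof (rule integral_mono)
        show "integrable M (\<lambda>x. norm (iexp (t * (X n x + R n x)) - iexp (t * X n x)))"
          by (intro integrable_norm Bochner_Integration.integrable_diff int) auto
        show "integrable M (\<lambda>x. \<bar>t\<bar> * \<epsilon> + 2 * indicator A x)"
          by (intro Bochner_Integration.integrable_add integrable_mult_right) (auto simp: emeasure_eq_measure)
        fix x assume x: "x \<in> space M"
        have "iexp (t * (X n x + R n x)) - iexp (t * X n x) = iexp (t * X n x) * (iexp (t * R n x) - 1)"
          by (simp add: ring_distribs exp_add)
        then have eq: "norm (iexp (t * (X n x + R n x)) - iexp (t * X n x)) = norm (iexp (t * R n x) - 1)"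
          by (simp add: norm_mult)
        show "norm (iexp (t * (X n x + R n x)) - iexp (t * X n x)) \<le> \<bar>t\<bar> * \<epsilon> + 2 * indicator A x"
        proof (cases "x \<in> A")
          case True
          have "norm (iexp (t * R n x) - 1) \<le> 2"
            using iexp_approx2[of "t * R n x" 0] by simp
          also have "\<dots> \<le> \<bar>t\<bar> * \<epsilon> + 2 * indicator A x"
            using \<epsilon> True by simp
          finally show ?thesis unfolding eq .
        next
          case False
          have "norm (iexp (t * R n x) - 1) \<le> \<bar>t * R n x\<bar>"
            using iexp_approx1[of "t * R n x" 0] by simp
          also have "\<dots> \<le> \<bar>t\<bar> * \<epsilon>"
            using False x by (auto simp: A_def abs_mult intro!: mult_left_mono)
          finally show ?thesis unfolding eq using False by simp
        qed
      qed
      also have "\<dots> = \<bar>t\<bar> * \<epsilon> + 2 * prob A"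
        by (subst Bochner_Integration.integral_add) (auto simp: emeasure_eq_measure prob_space)
      also have "\<dots> < r"
        using N[OF that] \<epsilon> by (simp add: A_def)
      finally show ?thesis by simp
    qed
    then show "\<exists>N. \<forall>n\<ge>N. norm (char (distr M borel (\<lambda>x. X n x + R n x)) t - char (distr M borel (X n)) t - 0) < r"
      by blast
  qed
  from tendsto_add[OF this conv[of t]]
  show "(\<lambda>n. char (distr M borel (\<lambda>x. X n x + R n x)) t) \<longlonglongrightarrow> char \<mu> t"
    by simp
qed

text \<open>Near x0 the remainder is below e |D| with e as small as desired, while Markov's
  inequality and the mean square bound keep sqrt n |D| bounded in probability.\<close>

lemma (in prob_space) delta_method_remainder:
  fixes H :: "'b::euclidean_space \<Rightarrow> real" and D :: "nat \<Rightarrow> 'a \<Rightarrow> 'b"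
  assumes deriv: "(H has_derivative H') (at x0)"
    and [measurable]: "H \<in> borel_measurable borel" "\<And>n. D n \<in> borel_measurable M"
    and int: "\<And>n. integrable M (\<lambda>x. (norm (D n x))\<^sup>2)"
    and le: "\<And>n. n > 0 \<Longrightarrow> expectation (\<lambda>x. (norm (D n x))\<^sup>2) \<le> C / real n"
    and "\<epsilon> > 0"
  shows "(\<lambda>n. prob {x \<in> space M. \<bar>sqrt (real n) * (H (x0 + D n x) - H x0 - H' (D n x))\<bar> \<ge> \<epsilon>}) \<longlonglongrightarrow> 0"
proof (rule LIMSEQ_I)
  fix r :: real assume r: "r > 0"
  have "C \<ge> 0"
  proof -
    have "0 \<le> expectation (\<lambda>x. (norm (D 1 x))\<^sup>2)" by simp
    also have "\<dots> \<le> C" using le[of 1] by simp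
    finally show ?thesis .
  qed
  have [measurable]: "H' \<in> borel_measurable borel"
    using has_derivative_bounded_linear[OF deriv]
    by (intro borel_measurable_continuous_onI linear_continuous_on)
  \<comment> \<open>Chosen so that C e^2 / \<epsilon>^2 <= r / 4; the summand 1 in C + 1 covers C =
    0.\<close>
  define e where "e = \<epsilon> * sqrt (r / (4 * (C + 1)))"
  have "e > 0"
    using r \<open>\<epsilon> > 0\<close> \<open>C \<ge> 0\<close> by (simp add: e_def)
  moreover have "C * e\<^sup>2 / \<epsilon>\<^sup>2 = (C / (C + 1)) * (r / 4)"
    using r \<open>\<epsilon> > 0\<close> \<open>C \<ge> 0\<close> by (simp add: e_def power_mult_distrib)
  moreover have "\<dots> \<le> 1 * (r / 4)"
    using r \<open>C \<ge> 0\<close> by (intro mult_right_mono) auto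
  ultimately have e: "e > 0" "C * e\<^sup>2 / \<epsilon>\<^sup>2 < r / 2"
    using r by auto
  obtain d where d: "d > 0"
    "\<And>y. norm (y - x0) < d \<Longrightarrow> \<bar>H y - H x0 - H' (y - x0)\<bar> \<le> e * norm (y - x0)"
    using deriv e(1) unfolding has_derivative_at_alt by auto
  have "(\<lambda>n. C / d\<^sup>2 / real n) \<longlonglongrightarrow> 0"
    by (rule lim_const_over_n)
  from order_tendstoD(2)[OF this, of "r / 2"] r
  obtain N where N: "\<And>n. n \<ge> N \<Longrightarrow> C / d\<^sup>2 / real n < r / 2"
    by (auto simp: eventually_sequentially)
  have "prob {x \<in> space M. \<bar>sqrt (real n) * (H (x0 + D n x) - H x0 - H' (D n x))\<bar> \<ge> \<epsilon>} < r"
    (is "prob ?A < r") if n: "n \<ge> max N 1" for n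
  proof -
    have n0: "n > 0" "real n > 0" using n by auto
    let ?B = "\<lambda>c. {x \<in> space M. (norm (D n x))\<^sup>2 \<ge> c}"
    define c where "c = \<epsilon>\<^sup>2 / (e\<^sup>2 * real n)"
    have c: "c > 0" using \<open>\<epsilon> > 0\<close> e n0 by (simp add: c_def)
    have markov: "prob (?B b) \<le> C / real n / b" if "b > 0" for b
    proof -
      have "prob (?B b) \<le> expectation (\<lambda>x. (norm (D n x))\<^sup>2) / b"
        by (rule integral_Markov_inequality_measure[OF int, of "{}"]) (use that in auto)
      also have "\<dots> \<le> C / real n / b"
        using le[OF n0(1)] that by (intro divide_right_mono) auto
      finally show ?thesis .
    qed
    \<comment> \<open>A large remainder means that either D leaves the ball of radius d, with
      probability O(1 / n), or e sqrt n |D| >= \<epsilon>, whose Markov bound C e^2 / \<epsilon>^2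
      is free of n.\<close>
    have "?A \<subseteq> ?B (d\<^sup>2) \<union> ?B c"
    proof (safe, rule ccontr)
      fix x assume x: "\<epsilon> \<le> \<bar>sqrt (real n) * (H (x0 + D n x) - H x0 - H' (D n x))\<bar>"
        and nd: "\<not> d\<^sup>2 \<le> (norm (D n x))\<^sup>2" and nc: "\<not> c \<le> (norm (D n x))\<^sup>2"
      from nd d(1) have "norm (D n x) < d"
        by (simp add: not_le power2_less_imp_less)
      then have "\<bar>H (x0 + D n x) - H x0 - H' (D n x)\<bar> \<le> e * norm (D n x)"
        using d(2)[of "x0 + D n x"] by simp
      then have "sqrt (real n) * \<bar>H (x0 + D n x) - H x0 - H' (D n x)\<bar> \<le> sqrt (real n) * (e * norm (D n x))"
        by (rule mult_left_mono) simp
      then have "\<epsilon> \<le> sqrt (real n) * (e * norm (D n x))"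
        using x by (simp add: abs_mult)
      then have "\<epsilon>\<^sup>2 \<le> (sqrt (real n) * (e * norm (D n x)))\<^sup>2"
        using \<open>\<epsilon> > 0\<close> by (intro power_mono) auto
      then have "\<epsilon>\<^sup>2 \<le> real n * e\<^sup>2 * (norm (D n x))\<^sup>2"
        by (simp add: power_mult_distrib mult_ac)
      then have "c \<le> (norm (D n x))\<^sup>2"
        using e n0 by (simp add: c_def field_simps)
      with nc show False by simp
    qed
    then have "prob ?A \<le> prob (?B (d\<^sup>2) \<union> ?B c)"
      by (intro finite_measure_mono) auto
    also have "\<dots> \<le> prob (?B (d\<^sup>2)) + prob (?B c)"
      by (intro measure_Un_le) auto
    also have "\<dots> \<le> C / real n / d\<^sup>2 + C / real n / c"
      using d c by (intro add_mono markov) auto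
    also have "C / real n / c = C * e\<^sup>2 / \<epsilon>\<^sup>2"
      using e n0 \<open>\<epsilon> > 0\<close> by (simp add: c_def field_simps)
    also have "C / real n / d\<^sup>2 + C * e\<^sup>2 / \<epsilon>\<^sup>2 < r"
    proof -
      have "C / real n / d\<^sup>2 = C / d\<^sup>2 / real n" by (simp add: mult.commute)
      moreover have "n \<ge> N" using n by simp
      ultimately show ?thesis using N[of n] e(2) by linarith
    qed
    finally show ?thesis .
  qed
  then show "\<exists>N. \<forall>n\<ge>N. norm (prob {x \<in> space M. \<bar>sqrt (real n) * (H (x0 + D n x) - H x0 - H' (D n x))\<bar> \<ge> \<epsilon>} - 0) < r"
    by (auto intro!: exI[of _ "max N 1"])
qed

section \<open>The estimator as a smooth function of sample moments\<close>

text \<open>The left-hand side is the second moment of \<alpha> T + c (T^2 - t2) for a centred T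
  with further moments t2, -2 z and t4. In the variables b = \<alpha>^2 and P = pi^2 the claim
  becomes rational arithmetic, because t2 and t4 occur multiplied by powers of \<alpha>.\<close>

lemma asymptotic_variance_identity:
  fixes \<alpha> L z t2 t4 :: real
  assumes \<alpha>: "\<alpha> > 0"
    and t2: "t2 = pi\<^sup>2 / (3 * \<alpha>\<^sup>2) - pi\<^sup>2 / 6"
    and t4: "\<alpha> ^ 4 * t4 = 7 * pi ^ 4 / 15 - \<alpha> ^ 4 * (3 * pi ^ 4 / 20) - \<alpha> ^ 4 * pi\<^sup>2 * t2"
  defines "c \<equiv> 3 * \<alpha>\<^sup>2 * L / (2 * pi\<^sup>2)"
  shows "\<alpha>\<^sup>2 * t2 + 2 * \<alpha> * c * (- 2 * z) + c\<^sup>2 * (t4 - t2\<^sup>2)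
    = (20 * pi ^ 4 * (2 - \<alpha>\<^sup>2) - 3 * pi\<^sup>2 * (\<alpha> ^ 4 + 20 * \<alpha>\<^sup>2 - 32) * L\<^sup>2 - 720 * \<alpha> ^ 3 * L * z) / (120 * pi\<^sup>2)"
proof -
  define P where "P = pi\<^sup>2"
  have P: "P \<noteq> 0" "pi ^ 4 = P\<^sup>2" by (simp_all add: P_def flip: power_mult)
  have a4: "\<alpha> ^ 4 = (\<alpha>\<^sup>2)\<^sup>2" by (simp flip: power_mult)
  define b where "b = \<alpha>\<^sup>2"
  have b: "b \<noteq> 0" using \<alpha> by (simp add: b_def)
  have bt2: "b * t2 = P / 3 - b * P / 6"
    unfolding t2 using b by (simp add: b_def P_def field_simps)
  have "c\<^sup>2 * (t4 - t2\<^sup>2) = 9 * L\<^sup>2 / (4 * P\<^sup>2) * (\<alpha> ^ 4 * t4 - (b * t2)\<^sup>2)"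
    unfolding a4 by (simp add: c_def P_def b_def field_simps power2_eq_square)
  also have "\<alpha> ^ 4 * t4 - (b * t2)\<^sup>2
      = 7 * P\<^sup>2 / 15 - b\<^sup>2 * (3 * P\<^sup>2 / 20) - b * P * (b * t2) - (b * t2)\<^sup>2"
    unfolding t4 unfolding P a4 by (simp add: b_def P_def power2_eq_square)
  also have "\<dots> = P\<^sup>2 * (- (b\<^sup>2 + 20 * b - 32) / 90)"
    unfolding bt2 by (simp add: field_simps power2_eq_square)
  also have "9 * L\<^sup>2 / (4 * P\<^sup>2) * \<dots> = - (b\<^sup>2 + 20 * b - 32) * L\<^sup>2 / 40"
    using P(1) by (simp add: field_simps)
  finally have 1: "c\<^sup>2 * (t4 - t2\<^sup>2) = - (b\<^sup>2 + 20 * b - 32) * L\<^sup>2 / 40" .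
  have 2: "\<alpha>\<^sup>2 * t2 = P * (2 - b) / 6"
    using bt2 by (simp add: b_def field_simps)
  have 3: "2 * \<alpha> * c * (- 2 * z) = - 6 * \<alpha> ^ 3 * L * z / P"
    by (simp add: c_def P_def power2_eq_square power3_eq_cube)
  show ?thesis
    unfolding 1 2 3 unfolding P a4 b_def[symmetric] P_def[symmetric]
    using P(1) by (simp add: field_simps power2_eq_square)
qed

text \<open>The coordinates are the birth frequency, the means of the shifted logarithms and of
  their squares, and 1 / (n - 1). With the last as a variable, one fixed function serves all sample
  sizes. The parameter \<open>l\<close> is the part of the shift other than Euler's constant, which
  the estimator itself adds.\<close>

definition lambda_functional :: "real \<Rightarrow> real \<times> real \<times> real \<times> real \<Rightarrow> real" where
  "lambda_functional l z = fst z * exp (- (pi / sqrt (3 * ((1 + snd (snd (snd z)))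
      * (fst (snd (snd z)) - (fst (snd z))\<^sup>2) + pi\<^sup>2 / 6))) * (fst (snd z) - l))"

lemma borel_measurable_lambda_functional [measurable]: "lambda_functional l \<in> borel_measurable borel"
proof -
  have [measurable]: "fst \<in> borel_measurable (borel :: (real \<times> real \<times> real \<times> real) measure)"
    "(\<lambda>z. fst (snd z)) \<in> borel_measurable (borel :: (real \<times> real \<times> real \<times> real) measure)"
    "(\<lambda>z. fst (snd (snd z))) \<in> borel_measurable (borel :: (real \<times> real \<times> real \<times> real) measure)"
    "(\<lambda>z. snd (snd (snd z))) \<in> borel_measurable (borel :: (real \<times> real \<times> real \<times> real) measure)"
    by (intro borel_measurable_continuous_onI continuous_intros)+
  show ?thesis
    unfolding lambda_functional_def by measurable
qed

lemma lambda_functional_value: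
  assumes "\<alpha> > 0" "\<theta> > 0"
  shows "lambda_functional (ln \<theta> / \<alpha>) (p, 0, pi\<^sup>2 / (3 * \<alpha>\<^sup>2) - pi\<^sup>2 / 6, 0) = p * \<theta>"
proof -
  have "3 * (pi\<^sup>2 / (3 * \<alpha>\<^sup>2)) = (pi / \<alpha>)\<^sup>2"
    by (simp add: power_divide)
  then have "sqrt (3 * (pi\<^sup>2 / (3 * \<alpha>\<^sup>2))) = pi / \<alpha>"
    using assms by (simp only: real_sqrt_unique) simp
  then show ?thesis
    using assms by (simp add: lambda_functional_def)
qed

text \<open>The exponent is - ah(V) (y - l). At y = 0 its derivative in V is l times the slope - 3
  \<alpha>^3 / (2 pi^2) of \<open>ah\<close>, which equals - c for l = ln \<theta> / \<alpha>. The
  squared mean is of second order there, and the correction factor 1 + u adds t2 du to the increment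
  of V.\<close>

lemma lambda_functional_has_derivative:
  assumes \<alpha>: "\<alpha> > 0" and \<theta>: "\<theta> > 0"
  defines "t2 \<equiv> pi\<^sup>2 / (3 * \<alpha>\<^sup>2) - pi\<^sup>2 / 6"
    and "c \<equiv> 3 * \<alpha>\<^sup>2 * ln \<theta> / (2 * pi\<^sup>2)"
  shows "(lambda_functional (ln \<theta> / \<alpha>) has_derivative
    (\<lambda>(dx, dy, dw, du). \<theta> * dx - p * \<theta> * (\<alpha> * dy + c * (dw + t2 * du)))) (at (p, 0, t2, 0))"
proof -
  define ah where "ah = (\<lambda>v. pi / sqrt (3 * (v + pi\<^sup>2 / 6)))"
  define V where "V = (\<lambda>z::real \<times> real \<times> real \<times> real. (1 + snd (snd (snd z))) * (fst (snd (snd z)) - (fst (snd z))\<^sup>2))"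
  define x0 where "x0 = (p, 0::real, t2, 0::real)"
  have t2': "t2 + pi\<^sup>2 / 6 = pi\<^sup>2 / (3 * \<alpha>\<^sup>2)" by (simp add: t2_def)
  have sq: "3 * (t2 + pi\<^sup>2 / 6) = (pi / \<alpha>)\<^sup>2"
    unfolding t2' by (simp add: power_divide)
  then have s: "sqrt (3 * (t2 + pi\<^sup>2 / 6)) = pi / \<alpha>"
    using \<alpha> by (simp only: real_sqrt_unique) simp
  have ah: "ah t2 = \<alpha>"
    unfolding ah_def s using \<alpha> by simp
  have pos: "3 * (t2 + pi\<^sup>2 / 6) > 0"
    unfolding sq using \<alpha> by simp
  have dah: "(ah has_real_derivative - 3 * \<alpha> ^ 3 / (2 * pi\<^sup>2)) (at t2)"
  proof -
    define g where "g = (\<lambda>v. sqrt (3 * (v + pi\<^sup>2 / 6)))"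
    have ahg: "ah = (\<lambda>v. pi / g v)"
      by (simp only: ah_def g_def)
    have "(g has_real_derivative inverse (sqrt (3 * (t2 + pi\<^sup>2 / 6))) / 2 * 3) (at t2)"
      unfolding g_def using pos by (auto intro!: derivative_eq_intros)
    then have dg: "(g has_real_derivative 3 / (2 * (pi / \<alpha>))) (at t2)"
      unfolding s using \<alpha> by (simp add: field_simps)
    have "g t2 = pi / \<alpha>" by (simp only: g_def s)
    then have "(ah has_real_derivative - (pi * (3 / (2 * (pi / \<alpha>)))) / (pi / \<alpha>)\<^sup>2) (at t2)"
      unfolding ahg using DERIV_divide[OF DERIV_const[of pi] dg] \<alpha>
      by (simp add: power2_eq_square)
    also have "- (pi * (3 / (2 * (pi / \<alpha>)))) / (pi / \<alpha>)\<^sup>2 = - 3 * \<alpha> ^ 3 / (2 * pi\<^sup>2)"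
      using \<alpha> by (simp add: field_simps power2_eq_square power3_eq_cube)
    finally show ?thesis .
  qed
  have V0: "V x0 = t2" by (simp add: V_def x0_def)
  have x0: "fst x0 = p" "fst (snd x0) = 0" by (simp_all add: x0_def)
  have dV: "(V has_derivative (\<lambda>z. fst (snd (snd z)) + t2 * snd (snd (snd z)))) (at x0)"
    unfolding V_def by (auto intro!: derivative_eq_intros simp: x0_def)
  have dahV: "((\<lambda>z. ah (V z)) has_derivative
      (\<lambda>z. (fst (snd (snd z)) + t2 * snd (snd (snd z))) * (- 3 * \<alpha> ^ 3 / (2 * pi\<^sup>2)))) (at x0)"
    using dah unfolding V0[symmetric] by (rule DERIV_compose_FDERIV[OF _ dV[unfolded V0[symmetric]]])
  define E where "E = (\<lambda>z. - ah (V z) * (fst (snd z) - ln \<theta> / \<alpha>))"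
  have dE: "(E has_derivative (\<lambda>z. - (\<alpha> * fst (snd z) + c * (fst (snd (snd z)) + t2 * snd (snd (snd z)))))) (at x0)"
    unfolding E_def
    by (rule derivative_eq_intros dahV refl)+
       (use \<alpha> in \<open>auto simp: V0 ah x0 c_def fun_eq_iff field_simps power2_eq_square power3_eq_cube\<close>)
  have E0: "exp (E x0) = \<theta>"
    using \<alpha> \<theta> by (simp add: E_def V0 ah x0)
  have "((\<lambda>z. fst z * exp (E z)) has_derivative (\<lambda>z. fst z * \<theta>
      - p * (\<theta> * (\<alpha> * fst (snd z) + c * (fst (snd (snd z)) + t2 * snd (snd (snd z))))))) (at x0)"
    by (rule derivative_eq_intros dE refl)+ (auto simp: E0 x0 algebra_simps)
  moreover have "(\<lambda>z. fst z * exp (E z)) = lambda_functional (ln \<theta> / \<alpha>)"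
    by (simp add: fun_eq_iff lambda_functional_def E_def ah_def V_def)
  ultimately show ?thesis
    unfolding x0_def by (simp add: case_prod_beta' mult_ac)
qed

lemma p_hat_eq_sum: "p_hat n b = (\<Sum>k<n. of_bool (b k)) / real n"
proof -
  have "(\<Sum>k<n. of_bool (b k)) = real (card ({..<n} \<inter> Collect b))"
    by (subst sum_of_bool_eq) auto
  also have "{..<n} \<inter> Collect b = {k. k < n \<and> b k}" by auto
  finally show ?thesis by (simp add: p_hat_def)
qed

text \<open>
  The factor \<open>1 + 1 / (n - 1) = n / (n - 1)\<close> is the bias correction of the sample variance, and
  the sample moments are those of \<open>ln (s k) + m\<close>.
\<close>

lemma lambda_hat_eq_functional:
  fixes s :: "nat \<Rightarrow> real" and b :: "nat \<Rightarrow> bool"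
  assumes n: "n \<ge> 2" and m: "m = l + euler_mascheroni"
  shows "lambda_hat n s b = lambda_functional l
    ((\<Sum>k<n. of_bool (b k)) / real n, (\<Sum>k<n. ln (s k) + m) / real n,
     (\<Sum>k<n. (ln (s k) + m)\<^sup>2) / real n, 1 / (real n - 1))"
proof -
  define x where "x = (\<lambda>k. ln (s k) + m)"
  define y where "y = (\<Sum>k<n. x k) / real n"
  define w where "w = (\<Sum>k<n. (x k)\<^sup>2) / real n"
  have n0: "real n > 0" "real n - 1 > 0" using n by auto
  have mean: "sample_mean n (\<lambda>k. ln (s k)) = y - m"
    using n0 by (simp add: sample_mean_def y_def x_def sum.distrib add_divide_distrib)
  have "(\<Sum>k<n. (ln (s k) - (y - m))\<^sup>2) = (\<Sum>k<n. (x k)\<^sup>2 - 2 * y * x k + y\<^sup>2)"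
    by (rule sum.cong) (auto simp: x_def power2_eq_square algebra_simps)
  also have "\<dots> = (\<Sum>k<n. (x k)\<^sup>2) - 2 * y * (\<Sum>k<n. x k) + real n * y\<^sup>2"
    by (simp add: sum.distrib sum_subtractf sum_distrib_left)
  also have "\<dots> = real n * (w - y\<^sup>2)"
  proof -
    have "(\<Sum>k<n. x k) = real n * y" "(\<Sum>k<n. (x k)\<^sup>2) = real n * w"
      using n0 by (simp_all add: y_def w_def)
    then show ?thesis by (simp only:) (simp add: power2_eq_square algebra_simps)
  qed
  finally have var: "sample_variance n (\<lambda>k. ln (s k)) = (1 + 1 / (real n - 1)) * (w - y\<^sup>2)"
    unfolding sample_variance_def mean using n0 by (simp add: field_simps)
  have "ln (s k) + m = x k" for k by (simp add: x_def)
  moreover have "y - m + euler_mascheroni = y - l" by (simp add: m)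
  ultimately show ?thesis
    unfolding lambda_hat_def p_hat_eq_sum theta_hat_def alpha_hat_def mean var
    by (simp add: lambda_functional_def y_def w_def)
qed

section \<open>Measurability, independence and non-degeneracy\<close>

lemma borel_measurable_lambda_hat:
  assumes [measurable]: "\<And>k. S k \<in> borel_measurable M" "\<And>k. B k \<in> measurable M (count_space UNIV)"
  shows "(\<lambda>\<omega>. lambda_hat n (\<lambda>k. S k \<omega>) (\<lambda>k. B k \<omega>)) \<in> borel_measurable M"
  unfolding lambda_hat_def p_hat_eq_sum theta_hat_def alpha_hat_def sample_variance_def sample_mean_def
  by measurable

text \<open>A measurable function of X generates a sub-sigma-algebra of that of X. This carries the
  independence of the two whole sequences over to their partial sums.\<close>

lemma (in prob_space) indep_var_of_indep_set_vimage_algebra: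
  assumes X: "X \<in> measurable M N" and Y: "Y \<in> measurable M L"
    and g: "g \<in> measurable N P" and h: "h \<in> measurable L R"
    and indep: "indep_set (sets (vimage_algebra (space M) X N)) (sets (vimage_algebra (space M) Y L))"
  shows "indep_var P (\<lambda>\<omega>. g (X \<omega>)) R (\<lambda>\<omega>. h (Y \<omega>))"
proof -
  have sub: "sigma_sets (space M) {(\<lambda>\<omega>. k (Z \<omega>)) -` A \<inter> space M | A. A \<in> sets P'} \<subseteq> sets (vimage_algebra (space M) Z N')"
    if Z: "Z \<in> measurable M N'" and k: "k \<in> measurable N' P'" for Z :: "'a \<Rightarrow> 'x" and N' k and P' :: "'y measure"
  proof -
    have "(\<lambda>\<omega>. k (Z \<omega>)) -` A \<inter> space M \<in> sets (vimage_algebra (space M) Z N')" if "A \<in> sets P'" for A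
    proof -
      have "(\<lambda>\<omega>. k (Z \<omega>)) -` A \<inter> space M = Z -` (k -` A \<inter> space N') \<inter> space M"
        using measurable_space[OF Z] by auto
      then show ?thesis
        using measurable_sets[OF k that] by (simp only: in_vimage_algebra)
    qed
    then show ?thesis
      using sets.sigma_sets_subset[of "{(\<lambda>\<omega>. k (Z \<omega>)) -` A \<inter> space M | A. A \<in> sets P'}" "vimage_algebra (space M) Z N'"]
      by auto
  qed
  have "indep_set (sigma_sets (space M) {(\<lambda>\<omega>. g (X \<omega>)) -` A \<inter> space M | A. A \<in> sets P})
      (sigma_sets (space M) {(\<lambda>\<omega>. h (Y \<omega>)) -` A \<inter> space M | A. A \<in> sets R})"
    unfolding indep_sets2_eq using sub[OF X g] sub[OF Y h] indep[unfolded indep_sets2_eq]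
    by (intro conjI ballI) (blast+)
  then show ?thesis
    unfolding indep_var_eq using measurable_compose[OF X g] measurable_compose[OF Y h] by (intro conjI)
qed

text \<open>Otherwise a polynomial in ln s would vanish almost surely; it is nonzero because a
  \<noteq> 0, even if c = 0, so its roots give finitely many s, a null set. The central limit
  theorem requires this positivity for the sojourn part.\<close>

lemma ml_quadratic_log_second_moment_pos:
  fixes \<alpha> \<theta> a b c m :: real
  assumes "a \<noteq> 0" "d \<noteq> 0"
    and prob: "prob_space (density lborel (\<lambda>t. ennreal (ml_density \<alpha> \<theta> t)))"
    and int: "integrable (density lborel (\<lambda>t. ennreal (ml_density \<alpha> \<theta> t)))
      (\<lambda>s. (d * (a * (ln s + m) + c * ((ln s + m)\<^sup>2 - b)))\<^sup>2)"
  shows "(\<integral>s. (d * (a * (ln s + m) + c * ((ln s + m)\<^sup>2 - b)))\<^sup>2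
      \<partial>density lborel (\<lambda>t. ennreal (ml_density \<alpha> \<theta> t))) > 0"
proof (rule ccontr)
  let ?Q = "density lborel (\<lambda>t. ennreal (ml_density \<alpha> \<theta> t))"
  let ?h = "\<lambda>s. d * (a * (ln s + m) + c * ((ln s + m)\<^sup>2 - b))"
  interpret prob_space ?Q by fact
  assume "\<not> (\<integral>s. (?h s)\<^sup>2 \<partial>?Q) > 0"
  then have "(\<integral>s. (?h s)\<^sup>2 \<partial>?Q) = 0"
    by (intro antisym) auto
  then have "AE s in ?Q. (?h s)\<^sup>2 = 0"
    by (subst (asm) integral_nonneg_eq_0_iff_AE[OF int]) auto
  moreover have "AE s in ?Q. s > 0"
    by (rule AE_ml_density_pos)
  moreover have "AE s in ?Q. s \<notin> (\<lambda>x. exp (x - m)) ` {x. poly [:- c * b, a, c:] x = 0}"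
  proof (subst AE_density)
    have "finite ((\<lambda>x. exp (x - m)) ` {x. poly [:- c * b, a, c:] x = 0})"
      using \<open>a \<noteq> 0\<close> by (intro finite_imageI poly_roots_finite) simp
    then have "AE s in lborel. s \<notin> (\<lambda>x. exp (x - m)) ` {x. poly [:- c * b, a, c:] x = 0}"
      by (intro AE_not_in finite_imp_null_set_lborel)
    then show "AE s in lborel. 0 < ennreal (ml_density \<alpha> \<theta> s) \<longrightarrow>
        s \<notin> (\<lambda>x. exp (x - m)) ` {x. poly [:- c * b, a, c:] x = 0}"
      by eventually_elim simp
  qed simp
  ultimately have "AE s in ?Q. False"
  proof eventually_elim
    case (elim s)
    then have "a * (ln s + m) + c * ((ln s + m)\<^sup>2 - b) = 0"
      using \<open>d \<noteq> 0\<close> by simp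
    then have "poly [:- c * b, a, c:] (ln s + m) = 0"
      by (simp add: algebra_simps power2_eq_square)
    moreover have "s = exp ((ln s + m) - m)"
      using elim by simp
    ultimately show False
      using elim(3) by blast
  qed
  then show False
    using AE_False by blast
qed

section \<open>Asymptotic normality of the birth rate estimator\<close>

theorem theorem4p1:
  fixes M :: "'a measure"
    and S :: "nat \<Rightarrow> 'a \<Rightarrow> real"
    and B :: "nat \<Rightarrow> 'a \<Rightarrow> bool"
    and \<alpha> lam \<mu> \<theta> p :: real
  assumes "prob_space M"
    and "0 < \<alpha>" and "\<alpha> \<le> 1" and "0 < lam" and "0 < \<mu>"
    and "\<theta> = lam + \<mu>" and "p = lam / \<theta>"
    and "\<And>k. distributed M lborel (S k) (\<lambda>t. ennreal (ml_density \<alpha> \<theta> t))"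
    and "prob_space.indep_vars M (\<lambda>_. borel) S UNIV"
    and "\<And>k. distr M (count_space UNIV) (B k) = measure_pmf (bernoulli_pmf p)"
    and "prob_space.indep_vars M (\<lambda>_. count_space UNIV) B UNIV"
    and "prob_space.indep_set M
           (sets (vimage_algebra (space M) (\<lambda>\<omega> k. S k \<omega>) (\<Pi>\<^sub>M k\<in>UNIV. borel)))
           (sets (vimage_algebra (space M) (\<lambda>\<omega> k. B k \<omega>) (\<Pi>\<^sub>M k\<in>UNIV. count_space UNIV)))"
  shows "weak_conv_m
           (\<lambda>n. distr M borel
             (\<lambda>\<omega>. sqrt (real n) * (lambda_hat n (\<lambda>k. S k \<omega>) (\<lambda>k. B k \<omega>) - lam)))
           (density lborel
             (normal_density 0 (sqrt (\<theta>\<^sup>2 * p * (1 - p) + p\<^sup>2 * sigma_theta_sq \<alpha> \<theta>))))"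
proof -
  interpret prob_space M by fact
  note \<alpha> = assms(2)
  have \<theta>: "\<theta> > 0"
    using assms(4-6) by simp
  have p: "0 < p" "p < 1" and lam: "p * \<theta> = lam"
    unfolding assms(7) using assms(4-6) \<theta> by simp_all
  note indep_S = assms(9) and indep_B = assms(11)
  have S_meas [measurable]: "S k \<in> borel_measurable M" for k
    using indep_S unfolding indep_vars_def2 by simp
  have B_meas [measurable]: "B k \<in> measurable M (count_space UNIV)" for k
    using indep_B unfolding indep_vars_def2 by simp
  define Q where "Q = density lborel (\<lambda>t. ennreal (ml_density \<alpha> \<theta> t))"
  have distr_S: "distr M borel (S k) = Q" for k
    using distributed_distr_eq_density[OF assms(8)[of k]] by (simp add: Q_def cong: distr_cong)
  have prob_Q: "prob_space Q"
    unfolding distr_S[of 0, symmetric] by (rule prob_space_distr) simp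
  have sets_Q [measurable_cong]: "sets Q = sets borel"
    by (simp add: Q_def)
  define T where "T = (\<lambda>x::real. ln x + ln \<theta> / \<alpha> + euler_mascheroni)"
  have [measurable]: "T \<in> borel_measurable borel"
    unfolding T_def by measurable
  define t2 where "t2 = pi\<^sup>2 / (3 * \<alpha>\<^sup>2) - pi\<^sup>2 / 6"
  define t4 where "t4 = (\<integral>x. T x ^ 4 \<partial>Q)"
  define c where "c = 3 * \<alpha>\<^sup>2 * ln \<theta> / (2 * pi\<^sup>2)"
  note moments = log_moments[OF prob_Q sets_Q _ \<alpha> \<theta>, unfolded Q_def,
      OF AE_ml_density_pos ml_laplace[OF \<alpha> \<theta> _ prob_Q[unfolded Q_def]], folded Q_def]
  interpret Q: prob_space Q by (rule prob_Q)
  have T_int: "integrable Q T" "integrable Q (\<lambda>x. T x ^ 2)" "integrable Q (\<lambda>x. T x ^ 3)" "integrable Q (\<lambda>x. T x ^ 4)"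
    using moments(1)[of 1] moments(1)[of 2] moments(1)[of 3] moments(1)[of 4] by (simp_all add: T_def)
  have T_mom: "(\<integral>x. T x \<partial>Q) = 0" "(\<integral>x. T x ^ 2 \<partial>Q) = t2" "(\<integral>x. T x ^ 3 \<partial>Q) = - 2 * riemann_zeta 3"
    "(\<integral>x. T x ^ 4 \<partial>Q) = t4"
    using moments(2-4) by (simp_all add: t2_def t4_def T_def)
  have t4: "\<alpha> ^ 4 * t4 = 7 * pi ^ 4 / 15 - \<alpha> ^ 4 * (3 * pi ^ 4 / 20) - \<alpha> ^ 4 * pi\<^sup>2 * t2"
    using moments(5) by (simp add: t2_def t4_def T_def)

  have S_integrable: "integrable M (\<lambda>\<omega>. h (S k \<omega>)) \<longleftrightarrow> integrable Q h"
    and S_expectation: "expectation (\<lambda>\<omega>. h (S k \<omega>)) = (\<integral>x. h x \<partial>Q)"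
    if [measurable]: "h \<in> borel_measurable borel" for h :: "real \<Rightarrow> real" and k
    unfolding distr_S[of k, symmetric] by (simp_all add: integrable_distr_eq integral_distr)
  have S_sum: "integrable M (\<lambda>\<omega>. (\<Sum>k<n. h (S k \<omega>))\<^sup>2)"
    "expectation (\<lambda>\<omega>. (\<Sum>k<n. h (S k \<omega>))\<^sup>2) = real n * (\<integral>x. (h x)\<^sup>2 \<partial>Q)"
    if [measurable]: "h \<in> borel_measurable borel" and "(\<integral>x. h x \<partial>Q) = 0" "integrable Q (\<lambda>x. (h x)\<^sup>2)"
    for h :: "real \<Rightarrow> real" and n
  proof -
    have "indep_vars (\<lambda>_. borel) (\<lambda>k \<omega>. h (S k \<omega>)) UNIV"
      by (rule indep_vars_compose2[OF indep_S]) simp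
    note * = indep_sum_square_expectation[OF this, of "\<integral>x. (h x)\<^sup>2 \<partial>Q" n]
    show "integrable M (\<lambda>\<omega>. (\<Sum>k<n. h (S k \<omega>))\<^sup>2)"
      "expectation (\<lambda>\<omega>. (\<Sum>k<n. h (S k \<omega>))\<^sup>2) = real n * (\<integral>x. (h x)\<^sup>2 \<partial>Q)"
      using that S_integrable[of "\<lambda>x. (h x)\<^sup>2"] S_expectation[of "\<lambda>x. (h x)\<^sup>2"] S_expectation[of h]
      by (auto intro!: *)
  qed
  have B_integrable: "integrable M (\<lambda>\<omega>. h (B k \<omega>))"
    and B_expectation: "expectation (\<lambda>\<omega>. h (B k \<omega>)) = h True * p + h False * (1 - p)"
    for h :: "bool \<Rightarrow> real" and k
  proof -
    have "integrable (distr M (count_space UNIV) (B k)) h"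
      unfolding assms(10) by (rule integrable_measure_pmf_finite) simp
    then show "integrable M (\<lambda>\<omega>. h (B k \<omega>))"
      by (subst (asm) integrable_distr_eq) auto
    have "expectation (\<lambda>\<omega>. h (B k \<omega>)) = (\<integral>x. h x \<partial>distr M (count_space UNIV) (B k))"
      by (subst integral_distr) auto
    also have "\<dots> = h True * p + h False * (1 - p)"
      unfolding assms(10) using p by simp
    finally show "expectation (\<lambda>\<omega>. h (B k \<omega>)) = h True * p + h False * (1 - p)" .
  qed
  define v where "v = (\<lambda>b. of_bool b - p)"
  \<comment> \<open>The factor a is 1 for the deviations \<open>D\<close> and \<theta> for the
    linear part \<open>X\<close>.\<close>
  have indep_vB: "indep_vars (\<lambda>_. borel) (\<lambda>k \<omega>. a * v (B k \<omega>)) UNIV" for a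
    by (rule indep_vars_compose2[OF indep_B]) simp
  have v_mean: "expectation (\<lambda>\<omega>. a * v (B k \<omega>)) = 0"
    and v_var: "expectation (\<lambda>\<omega>. (a * v (B k \<omega>))\<^sup>2) = a\<^sup>2 * (p * (1 - p))"
    and v_int: "integrable M (\<lambda>\<omega>. (a * v (B k \<omega>))\<^sup>2)" for a k
    using B_expectation[of "\<lambda>b. a * v b"] B_expectation[of "\<lambda>b. (a * v b)\<^sup>2"] B_integrable[of "\<lambda>b. (a * v b)\<^sup>2"]
    by (auto simp: v_def algebra_simps power2_eq_square)

  define u where "u = (\<lambda>s. (T s)\<^sup>2 - t2)"
  \<comment> \<open>The contribution of one sojourn time to the derivative of the estimator, in the
    directions of the two sample moments of T.\<close>
  define f where "f = (\<lambda>s. - (p * \<theta>) * (\<alpha> * T s + c * u s))"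
  have [measurable]: "u \<in> borel_measurable borel" "f \<in> borel_measurable borel"
    unfolding u_def f_def by measurable
  have u_sq: "(u x)\<^sup>2 = T x ^ 4 - 2 * t2 * T x ^ 2 + t2\<^sup>2" for x
    by (simp add: u_def power2_eq_square power4_eq_xxxx algebra_simps)
  have u_int: "integrable Q u" "integrable Q (\<lambda>x. (u x)\<^sup>2)"
    unfolding u_sq unfolding u_def using T_int by auto
  have u_mom: "(\<integral>x. u x \<partial>Q) = 0" "(\<integral>x. (u x)\<^sup>2 \<partial>Q) = t4 - t2\<^sup>2"
    unfolding u_sq unfolding u_def using T_int T_mom Q.prob_space by (auto simp: power2_eq_square)
  have f_sq: "(f x)\<^sup>2 = (p * \<theta>)\<^sup>2 * (\<alpha>\<^sup>2 * T x ^ 2 + 2 * \<alpha> * c * (T x ^ 3 - t2 * T x) + c\<^sup>2 * (u x)\<^sup>2)" for x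
    by (simp add: f_def u_def power2_eq_square power3_eq_cube algebra_simps)
  have f_int: "integrable Q (\<lambda>x. (f x)\<^sup>2)"
    unfolding f_sq using T_int u_int by auto
  have f_mean: "(\<integral>x. f x \<partial>Q) = 0"
    unfolding f_def using T_int u_int T_mom u_mom by simp
  define v1 where "v1 = (\<integral>x. (f x)\<^sup>2 \<partial>Q)"
  have v1: "v1 = p\<^sup>2 * sigma_theta_sq \<alpha> \<theta>"
  proof -
    have "v1 = (p * \<theta>)\<^sup>2 * (\<alpha>\<^sup>2 * t2 + 2 * \<alpha> * c * (- 2 * riemann_zeta 3) + c\<^sup>2 * (t4 - t2\<^sup>2))"
      unfolding v1_def f_sq using T_int u_int T_mom u_mom by simp
    also have "\<dots> = p\<^sup>2 * sigma_theta_sq \<alpha> \<theta>"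
      unfolding asymptotic_variance_identity[OF \<alpha> t2_def t4, of "ln \<theta>", folded c_def] sigma_theta_sq_def
      by (simp add: power_mult_distrib)
    finally show ?thesis .
  qed
  have v1_pos: "v1 > 0"
    using ml_quadratic_log_second_moment_pos[of \<alpha> "- (p * \<theta>)" \<alpha> \<theta> "ln \<theta> / \<alpha> + euler_mascheroni" c t2,
        folded Q_def] prob_Q f_int \<alpha> \<theta> p
    by (simp add: v1_def f_def u_def T_def add.assoc)

  \<comment> \<open>Limit law of the linear part\<close>
  define X where "X = (\<lambda>n \<omega>. (\<Sum>k<n. f (S k \<omega>)) / sqrt (real n) + (\<Sum>k<n. \<theta> * v (B k \<omega>)) / sqrt (real n))"
  define \<sigma> where "\<sigma> = sqrt (\<theta>\<^sup>2 * p * (1 - p) + p\<^sup>2 * sigma_theta_sq \<alpha> \<theta>)"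
  have v2_pos: "\<theta>\<^sup>2 * (p * (1 - p)) > 0"
    using p \<theta> by simp
  have \<sigma>_sq: "\<sigma>\<^sup>2 = v1 + \<theta>\<^sup>2 * (p * (1 - p))" and "\<sigma> > 0"
    unfolding \<sigma>_def v1[symmetric] using v1_pos v2_pos by (auto simp: mult.assoc add.commute intro: add_pos_pos)
  have X_conv: "(\<lambda>n. char (distr M borel (X n)) t) \<longlonglongrightarrow> char (density lborel (normal_density 0 \<sigma>)) t" for t
  proof -
    \<comment> \<open>Each sum is a function of one whole sequence, so the characteristic function
      of X n is a product; in the limit the Gaussian exponents, hence the variances, add up.\<close>
    have "indep_var borel (\<lambda>\<omega>. (\<Sum>k<n. f (S k \<omega>)) / sqrt (real n))
        borel (\<lambda>\<omega>. (\<Sum>k<n. \<theta> * v (B k \<omega>)) / sqrt (real n))" for n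
      by (rule indep_var_of_indep_set_vimage_algebra[OF _ _ _ _ assms(12),
            of "\<lambda>s. (\<Sum>k<n. f (s k)) / sqrt (real n)" borel "\<lambda>b. (\<Sum>k<n. \<theta> * v (b k)) / sqrt (real n)" borel])
         (auto intro: measurable_abs_UNIV)
    then have eq: "char (distr M borel (X n)) t
        = char (distr M borel (\<lambda>\<omega>. (\<Sum>k<n. f (S k \<omega>)) / sqrt (real n))) t
          * char (distr M borel (\<lambda>\<omega>. (\<Sum>k<n. \<theta> * v (B k \<omega>)) / sqrt (real n))) t" for n
      unfolding X_def by (rule char_distr_add)
    have "(\<lambda>n. char (distr M borel (\<lambda>\<omega>. (\<Sum>k<n. f (S k \<omega>)) / sqrt (real n))) t)
        \<longlonglongrightarrow> complex_of_real (exp (- (v1 * t\<^sup>2) / 2))"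
    proof (rule char_scaled_sum_tendsto)
      show "indep_vars (\<lambda>_. borel) (\<lambda>k \<omega>. f (S k \<omega>)) UNIV"
        by (rule indep_vars_compose2[OF indep_S]) simp
      show "distr M borel (\<lambda>\<omega>. f (S k \<omega>)) = distr Q borel f" for k
        unfolding distr_S[of k, symmetric] by (subst distr_distr) (auto simp: comp_def)
    qed (use f_int f_mean v1_pos S_integrable[of "\<lambda>x. (f x)\<^sup>2"] S_expectation[of "\<lambda>x. (f x)\<^sup>2"] S_expectation[of f]
        in \<open>auto simp: v1_def\<close>)
    moreover have "(\<lambda>n. char (distr M borel (\<lambda>\<omega>. (\<Sum>k<n. \<theta> * v (B k \<omega>)) / sqrt (real n))) t)
        \<longlonglongrightarrow> complex_of_real (exp (- (\<theta>\<^sup>2 * (p * (1 - p)) * t\<^sup>2) / 2))"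
    proof (rule char_scaled_sum_tendsto[OF indep_vB v_mean v_int v_var v2_pos])
      show "distr M borel (\<lambda>\<omega>. \<theta> * v (B k \<omega>)) = distr (measure_pmf (bernoulli_pmf p)) borel (\<lambda>b. \<theta> * v b)" for k
        unfolding assms(10)[of k, symmetric] by (subst distr_distr) (auto simp: comp_def)
    qed
    ultimately have "(\<lambda>n. char (distr M borel (X n)) t)
        \<longlonglongrightarrow> complex_of_real (exp (- (v1 * t\<^sup>2) / 2)) * complex_of_real (exp (- (\<theta>\<^sup>2 * (p * (1 - p)) * t\<^sup>2) / 2))"
      unfolding eq by (rule tendsto_mult)
    also have "complex_of_real (exp (- (v1 * t\<^sup>2) / 2)) * complex_of_real (exp (- (\<theta>\<^sup>2 * (p * (1 - p)) * t\<^sup>2) / 2))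
        = complex_of_real (exp (- (\<sigma>\<^sup>2 * t\<^sup>2) / 2))"
      unfolding \<sigma>_sq of_real_mult[symmetric] mult_exp_exp
      by (rule arg_cong[where f="\<lambda>x. complex_of_real (exp x)"]) (simp add: field_simps)
    finally show ?thesis
      by (simp only: char_normal[OF \<open>\<sigma> > 0\<close>])
  qed

  \<comment> \<open>Linearisation and remainder\<close>
  define H where "H = lambda_functional (ln \<theta> / \<alpha>)"
  define H' where "H' = (\<lambda>(dx, dy, dw, du). \<theta> * dx - p * \<theta> * (\<alpha> * dy + c * (dw + t2 * du)))"
  define x0 where "x0 = (p, 0::real, t2, 0::real)"
  define D where "D = (\<lambda>n \<omega>. ((\<Sum>k<n. v (B k \<omega>)) / real n, (\<Sum>k<n. T (S k \<omega>)) / real n,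
      (\<Sum>k<n. u (S k \<omega>)) / real n, 1 / (real n - 1)))"
  have H: "(H has_derivative H') (at x0)"
    unfolding H_def H'_def x0_def t2_def c_def by (rule lambda_functional_has_derivative[OF \<alpha> \<theta>])
  have H_x0: "H x0 = lam"
    unfolding H_def x0_def t2_def lam[symmetric] by (rule lambda_functional_value[OF \<alpha> \<theta>])
  have H_D: "lambda_hat n (\<lambda>k. S k \<omega>) (\<lambda>k. B k \<omega>) = H (x0 + D n \<omega>)" if "n \<ge> 2" for n \<omega>
    using that unfolding H_def
    by (subst lambda_hat_eq_functional[OF that refl])
       (simp add: x0_def D_def v_def u_def T_def sum_subtractf diff_divide_distrib add.assoc)
  have norm_D: "(norm (D n \<omega>))\<^sup>2 = (\<Sum>k<n. v (B k \<omega>))\<^sup>2 / (real n)\<^sup>2 + (\<Sum>k<n. T (S k \<omega>))\<^sup>2 / (real n)\<^sup>2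
      + (\<Sum>k<n. u (S k \<omega>))\<^sup>2 / (real n)\<^sup>2 + (1 / (real n - 1))\<^sup>2" for n \<omega>
    by (simp add: D_def norm_Pair power_divide)
  have D_int: "integrable M (\<lambda>\<omega>. (\<Sum>k<n. v (B k \<omega>))\<^sup>2)" "expectation (\<lambda>\<omega>. (\<Sum>k<n. v (B k \<omega>))\<^sup>2) = real n * (p * (1 - p))"
    "integrable M (\<lambda>\<omega>. (\<Sum>k<n. T (S k \<omega>))\<^sup>2)" "expectation (\<lambda>\<omega>. (\<Sum>k<n. T (S k \<omega>))\<^sup>2) = real n * t2"
    "integrable M (\<lambda>\<omega>. (\<Sum>k<n. u (S k \<omega>))\<^sup>2)" "expectation (\<lambda>\<omega>. (\<Sum>k<n. u (S k \<omega>))\<^sup>2) = real n * (t4 - t2\<^sup>2)" for n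
    using indep_sum_square_expectation[OF indep_vB[of 1] v_mean v_int v_var, of n]
      S_sum[of T n] S_sum[of u n] T_int T_mom u_int u_mom by simp_all
  define W where "W = (\<lambda>n \<omega>. sqrt (real n) * (H (x0 + D n \<omega>) - H x0 - H' (D n \<omega>)))"
  have W_negl: "(\<lambda>n. prob {\<omega> \<in> space M. \<bar>W n \<omega>\<bar> \<ge> \<epsilon>}) \<longlonglongrightarrow> 0"
    if "\<epsilon> > 0" for \<epsilon>
    unfolding W_def
  proof (rule delta_method_remainder[OF H _ _ _ _ that])
    show "H \<in> borel_measurable borel" unfolding H_def by measurable
    show "D n \<in> borel_measurable M" for n unfolding D_def by (intro borel_measurable_Pair) measurable
    show "integrable M (\<lambda>\<omega>. (norm (D n \<omega>))\<^sup>2)" for n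
      unfolding norm_D using D_int[of n] by auto
    show "expectation (\<lambda>\<omega>. (norm (D n \<omega>))\<^sup>2) \<le> (p * (1 - p) + t2 + (t4 - t2\<^sup>2) + 4) / real n" if "n > 0" for n
    proof -
      have cancel: "real n * x / (real n)\<^sup>2 = x / real n" for x
        by (simp add: power2_eq_square)
      have "expectation (\<lambda>\<omega>. (norm (D n \<omega>))\<^sup>2) = real n * (p * (1 - p)) / (real n)\<^sup>2
          + real n * t2 / (real n)\<^sup>2 + real n * (t4 - t2\<^sup>2) / (real n)\<^sup>2 + (1 / (real n - 1))\<^sup>2"
        unfolding norm_D using D_int[of n] prob_space by simp
      also have "\<dots> = (p * (1 - p) + t2 + (t4 - t2\<^sup>2)) / real n + (1 / (real n - 1))\<^sup>2"
        unfolding cancel by (simp add: add_divide_distrib)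
      \<comment> \<open>For n >= 2 one has n - 1 >= n / 2 and (2 / n)^2 <= 4 / n; for n = 1 division
        by zero gives 0.\<close>
      also have "(1 / (real n - 1))\<^sup>2 \<le> 4 / real n"
      proof (cases "n = 1")
        case False
        with that have n: "real n \<ge> 2" by simp
        then have "(1 / (real n - 1))\<^sup>2 \<le> (2 / real n)\<^sup>2"
          by (intro power_mono) (auto simp: field_simps)
        also have "\<dots> \<le> 4 / real n"
          using n by (simp add: power2_eq_square field_simps)
        finally show ?thesis .
      qed simp
      finally show ?thesis by (simp add: add_divide_distrib)
    qed
  qed

  define R where "R = (\<lambda>n \<omega>. sqrt (real n) * (lambda_hat n (\<lambda>k. S k \<omega>) (\<lambda>k. B k \<omega>) - lam) - X n \<omega>)"
  \<comment> \<open>\<open>X\<close> omits the du-direction of \<open>H'\<close>. With du = 1 / (n -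
    1) this direction contributes - \<kappa> sqrt n / (n - 1), a deterministic term of order 1 /
    sqrt n that joins the remainder.\<close>
  define \<kappa> where "\<kappa> = p * \<theta> * c * t2"
  have R_eq: "R n \<omega> = W n \<omega> - \<kappa> * (sqrt (real n) / (real n - 1))"
    if "n \<ge> 2" for n \<omega>
  proof -
    have sq: "sqrt (real n) * (x / real n) = x / sqrt (real n)" for x
      using that by (simp add: real_div_sqrt field_simps)
    have fs: "(\<Sum>k<n. f (S k \<omega>)) = - (p * \<theta>) * (\<alpha> * (\<Sum>k<n. T (S k \<omega>)) + c * (\<Sum>k<n. u (S k \<omega>)))"
      unfolding f_def sum_distrib_left[symmetric] sum.distrib by (simp add: sum_distrib_left)
    have "X n \<omega> = \<theta> * (sqrt (real n) * ((\<Sum>k<n. v (B k \<omega>)) / real n))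
        - p * \<theta> * (\<alpha> * (sqrt (real n) * ((\<Sum>k<n. T (S k \<omega>)) / real n))
          + c * (sqrt (real n) * ((\<Sum>k<n. u (S k \<omega>)) / real n)))"
      unfolding X_def sq fs sum_distrib_left[symmetric] by (simp add: divide_inverse algebra_simps)
    also have "\<dots> = sqrt (real n) * H' (D n \<omega>) + \<kappa> * (sqrt (real n) / (real n - 1))"
    proof -
      define a1 where "a1 = (\<Sum>k<n. v (B k \<omega>)) / real n"
      define a2 where "a2 = (\<Sum>k<n. T (S k \<omega>)) / real n"
      define a3 where "a3 = (\<Sum>k<n. u (S k \<omega>)) / real n"
      define a4 where "a4 = 1 / (real n - 1)"
      have "D n \<omega> = (a1, a2, a3, a4)" "sqrt (real n) / (real n - 1) = sqrt (real n) * a4"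
        by (simp_all add: D_def a1_def a2_def a3_def a4_def)
      then show ?thesis
        unfolding a1_def[symmetric] a2_def[symmetric] a3_def[symmetric] H'_def \<kappa>_def
        by (simp add: algebra_simps)
    qed
    finally show ?thesis
      unfolding R_def W_def H_D[OF that] H_x0 by (simp add: algebra_simps)
  qed
  have "weak_conv_m (\<lambda>n. distr M borel (\<lambda>\<omega>. X n \<omega> + R n \<omega>)) (density lborel (normal_density 0 \<sigma>))"
  proof (rule weak_conv_m_add_negligible[OF _ _ char_normal(2)[OF \<open>\<sigma> > 0\<close>] X_conv])
    show X_meas [measurable]: "X n \<in> borel_measurable M" for n
      unfolding X_def by measurable
    show R_meas [measurable]: "R n \<in> borel_measurable M" for n
      unfolding R_def using borel_measurable_lambda_hat[OF S_meas B_meas] by measurable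
    fix \<epsilon> :: real assume "\<epsilon> > 0"
    have "(\<lambda>n. \<kappa> * (sqrt (real n) / (real n - 1))) \<longlonglongrightarrow> \<kappa> * 0"
      by (intro tendsto_mult tendsto_const) real_asymp
    then have "\<forall>\<^sub>F n in sequentially. dist (\<kappa> * (sqrt (real n) / (real n - 1))) (\<kappa> * 0) < \<epsilon> / 2"
      by (rule tendstoD) (use \<open>\<epsilon> > 0\<close> in simp)
    then have "\<forall>\<^sub>F n in sequentially. \<bar>\<kappa> * (sqrt (real n) / (real n - 1))\<bar> < \<epsilon> / 2"
      by (simp only: dist_real_def mult_zero_right diff_zero)
    then have le: "\<forall>\<^sub>F n in sequentially. prob {\<omega> \<in> space M. \<bar>R n \<omega>\<bar> \<ge> \<epsilon>}
        \<le> prob {\<omega> \<in> space M. \<bar>W n \<omega>\<bar> \<ge> \<epsilon> / 2}"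
      using eventually_ge_at_top[of 2]
    proof eventually_elim
      case (elim n)
      \<comment> \<open>Once the deterministic term is below \<epsilon> / 2, |R| >= \<epsilon>
        forces |W| >= \<epsilon> / 2.\<close>
      have "{\<omega> \<in> space M. \<bar>R n \<omega>\<bar> \<ge> \<epsilon>}
          \<subseteq> {\<omega> \<in> space M. \<bar>W n \<omega>\<bar> \<ge> \<epsilon> / 2}"
        using elim by (auto simp only: R_eq)
      moreover have [measurable]: "W n \<in> borel_measurable M"
      proof -
        have "W n = (\<lambda>\<omega>. R n \<omega> + \<kappa> * (sqrt (real n) / (real n - 1)))"
          using elim by (simp add: R_eq fun_eq_iff)
        then show ?thesis by simp
      qed
      then have "{\<omega> \<in> space M. \<bar>W n \<omega>\<bar> \<ge> \<epsilon> / 2} \<in> sets M"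
        by measurable
      ultimately show ?case
        by (rule finite_measure_mono)
    qed
    show "(\<lambda>n. prob {\<omega> \<in> space M. \<bar>R n \<omega>\<bar> \<ge> \<epsilon>}) \<longlonglongrightarrow> 0"
      by (rule tendsto_sandwich[OF _ le tendsto_const W_negl]) (use \<open>\<epsilon> > 0\<close> in simp_all)
  qed
  then show ?thesis
    by (simp add: R_def \<sigma>_def)
qed

end
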